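(* Let $F_2=\langle a,b\rangle$ be the free group on $a,b$ and let $P_4\subset F_2$ be the subgroup generated by the fourth powers of all primitive elements of $F_2$. Let $\tilde{\tilde\rho}_4:F_2\to\mathrm{GL}(9,\mathbb{C})$ be the homomorphism determined by $$\tilde{\tilde\rho}_4(a)=\mathrm{diag}(1,-1,-i,-i,-1,1,i,i,1),$$ $$\tilde{\tilde\rho}_4(b)=\begin{pmatrix} 0 & 0 & 0 & 0 & 0 & 1 & 1 & 0 & 0 \\ 0 & 0 & 0 & 0 & -1 & 0 & 0 & 1 & 0 \\ 0 & 0 & 0 & 0 & 0 & 0 & 1 & 0 & 1 \\ 0 & 0 & 0 & 0 & 0 & 0 & 0 & 1 & 0 \\ 0 & -1 & -1 & 0 & 0 & 0 & 0 & 0 & 0 \\ 1 & 0 & 0 & -1 & 0 & 0 & 0 & 0 & 0 \\ 0 & 0 & -1 & 0 & 0 & 0 & 0 & 0 & 0 \\ 0 & 0 & 0 & -1 & 0 & 0 & 0 & 0 & -1 \\ 0 & 0 & 0 & 0 & 0 & 0 & 0 & 0 & 1 \end{pmatrix},$$ which satisfies $P_4\subset\ker\tilde{\tilde\rho}_4$. Then the induced representation $\tilde{\tilde\rho}_4:F_2/P_4\to\mathrm{GL}(9,\mathbb{C})$ is faithful. Moreover, let $\tilde\rho_4:F_2\to\mathrm{GL}(4,\mathbb{C})$ be the homomorphism determined by $$\tilde\rho_4(a)=\begin{pmatrix} i&0&0&0\\0&-i&0&0\\0&0&1&0\\0&0&0&1\end{pmatrix},\qquad \tilde\rho_4(b)=\begin{pmatrix}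 0&1&1&0\\-1&0&0&1\\0&0&1&0\\0&0&0&1\end{pmatrix},$$ for which $\ker\tilde{\tilde\rho}_4\subset\ker\tilde\rho_4$. Then, in the short exact sequence $$1\to\mathbb{Z}^d\to F_2/\ker\tilde{\tilde\rho}_4\to F_2/\ker\tilde\rho_4\to 1$$ given by the natural surjection (whose kernel $\tilde{\tilde\rho}_4(\ker\tilde\rho_4)$ is free abelian of some rank $d\ge 1$), one has $d=1$.
   Context: An element of $F_2$ is primitive if it belongs to some two-element generating set of $F_2$. The subgroup $P_4$ is characteristic, hence normal, in $F_2$. The natural surjection $F_2/\ker\tilde{\tilde\rho}_4\to F_2/\ker\tilde\rho_4$ is the quotient map; $\ker\tilde\rho_4/\ker\tilde{\tilde\rho}_4$ is identified with $\tilde{\tilde\rho}_4(\ker\tilde\rho_4)$. *)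

theory Defs
  imports
    "HOL-Algebra.Exact_Sequence"
    "HOL-Algebra.Product_Groups"
    "Jordan_Normal_Form.Matrix"
begin

datatype f2_gen = Gen_a | Gen_b

text \<open>The letter \<open>(x, True)\<close> stands for the generator \<open>x\<close> and \<open>(x, False)\<close> for its inverse.
  A group element is a freely reduced word.\<close>

type_synonym f2_word = "(f2_gen \<times> bool) list"

definition inv_letter :: "f2_gen \<times> bool \<Rightarrow> f2_gen \<times> bool" where
  "inv_letter l = (fst l, \<not> snd l)"

definition reduced :: "f2_word \<Rightarrow> bool" where
  "reduced w \<longleftrightarrow> successively (\<lambda>l l'. l' \<noteq> inv_letter l) w"

text \<open>Left multiplication of a reduced word by a letter.\<close>

fun push :: "f2_gen \<times> bool \<Rightarrow> f2_word \<Rightarrow> f2_word" where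
  "push l [] = [l]"
| "push l (l' # w) = (if l' = inv_letter l then w else l # l' # w)"

definition F2 :: "f2_word monoid" where
  "F2 = \<lparr>carrier = {w. reduced w}, monoid.mult = (\<lambda>u v. foldr push u v), one = []\<rparr>"

definition gen_a :: f2_word where "gen_a = [(Gen_a, True)]"
definition gen_b :: f2_word where "gen_b = [(Gen_b, True)]"

definition primitive :: "f2_word \<Rightarrow> bool" where
  "primitive x \<longleftrightarrow> (\<exists>S \<subseteq> carrier F2. card S = 2 \<and> generate F2 S = carrier F2 \<and> x \<in> S)"

definition P4 :: "f2_word set" where
  "P4 = generate F2 {x [^]\<^bsub>F2\<^esub> (4::nat) | x. primitive x}"

definition GL :: "nat \<Rightarrow> complex mat monoid" where
  "GL n = units_of (ring_mat TYPE(complex) n ())"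

definition rho44_a :: "complex mat" where
  "rho44_a = mat_diag 9 (\<lambda>k. [1, -1, -\<i>, -\<i>, -1, 1, \<i>, \<i>, 1] ! k)"

definition rho44_b :: "complex mat" where
  "rho44_b = mat_of_rows_list 9
    [[0,  0,  0,  0,  0, 1, 1, 0,  0],
     [0,  0,  0,  0, -1, 0, 0, 1,  0],
     [0,  0,  0,  0,  0, 0, 1, 0,  1],
     [0,  0,  0,  0,  0, 0, 0, 1,  0],
     [0, -1, -1,  0,  0, 0, 0, 0,  0],
     [1,  0,  0, -1,  0, 0, 0, 0,  0],
     [0,  0, -1,  0,  0, 0, 0, 0,  0],
     [0,  0,  0, -1,  0, 0, 0, 0, -1],
     [0,  0,  0,  0,  0, 0, 0, 0,  1]]"

definition rho4_a :: "complex mat" where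
  "rho4_a = mat_of_rows_list 4
    [[\<i>,   0, 0, 0],
     [0, -\<i>, 0, 0],
     [0,   0, 1, 0],
     [0,   0, 0, 1]]"

definition rho4_b :: "complex mat" where
  "rho4_b = mat_of_rows_list 4
    [[ 0, 1, 1, 0],
     [-1, 0, 0, 1],
     [ 0, 0, 1, 0],
     [ 0, 0, 0, 1]]"

text \<open>If \<open>f\<close> is constant on each coset of \<open>N\<close>, this is the map that \<open>f\<close> induces on the quotient
  by \<open>N\<close>, sending \<open>N g\<close> to \<open>f g\<close> (as in \<^theory>\<open>HOL-Algebra.Coset\<close>).\<close>

definition induced :: "('a \<Rightarrow> 'b) \<Rightarrow> 'a set \<Rightarrow> 'b" where
  "induced f C = the_elem (f ` C)"

text \<open>The natural surjection from \<open>F2 Mod M\<close> to \<open>F2 Mod N\<close> for normal subgroups \<open>M \<subseteq> N\<close>; as a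
  function on cosets \<open>M g\<close> it does not depend on \<open>M\<close>.\<close>

definition quot_map :: "f2_word set \<Rightarrow> f2_word set \<Rightarrow> f2_word set" where
  "quot_map N = induced (\<lambda>g. N #>\<^bsub>F2\<^esub> g)"

text \<open>The sequence \<open>1 \<rightarrow> A \<rightarrow> B \<rightarrow> C \<rightarrow> 1\<close> with maps \<open>f\<close> and \<open>g\<close> is exact. The library's
  \<^const>\<open>short_exact_sequence\<close> requires the three groups to have the same element type.\<close>

definition short_exact ::
  "'a monoid \<Rightarrow> 'b monoid \<Rightarrow> 'c monoid \<Rightarrow> ('a \<Rightarrow> 'b) \<Rightarrow> ('b \<Rightarrow> 'c) \<Rightarrow> bool" where
  "short_exact A B C f g \<longleftrightarrow>
     group A \<and> group B \<and> group C \<and> f \<in> mon A B \<and> g \<in> epi B C \<and>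
     f ` carrier A = kernel B C g"

definition Z_pow :: "nat \<Rightarrow> (nat \<Rightarrow> int) monoid" where
  "Z_pow d = product_group {..<d} (\<lambda>_. integer_group)"

lemma inv_letter_inv_letter [simp]: "inv_letter (inv_letter l) = l"
  by (simp add: inv_letter_def)

lemma inv_letter_neq [simp]: "inv_letter l \<noteq> l" "l \<noteq> inv_letter l"
  by (cases l; simp add: inv_letter_def)+

lemma reduced_Nil [simp]: "reduced []"
  by (simp add: reduced_def)

lemma reduced_single [simp]: "reduced [l]"
  by (simp add: reduced_def)

lemma reduced_Cons_Cons [simp]:
  "reduced (l # l' # w) \<longleftrightarrow> l' \<noteq> inv_letter l \<and> reduced (l' # w)"
  by (simp add: reduced_def)

lemma reduced_tl: "reduced (l # w) \<Longrightarrow> reduced w"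
  by (cases w) auto

lemma reduced_push: "reduced w \<Longrightarrow> reduced (push l w)"
  by (cases w) (auto dest: reduced_tl)

lemma reduced_foldr_push: "reduced v \<Longrightarrow> reduced (foldr push u v)"
  by (induction u) (auto intro: reduced_push)

lemma push_inv_letter: "reduced w \<Longrightarrow> push l (push (inv_letter l) w) = w"
proof (cases w)
  case (Cons l' w')
  assume "reduced w"
  with Cons show ?thesis by (cases w') auto
qed auto

lemma push_inv_letter': "reduced w \<Longrightarrow> push (inv_letter l) (push l w) = w"
  using push_inv_letter[of w "inv_letter l"] by simp

lemma foldr_push_push:
  assumes "reduced w"
  shows "foldr push (push l v) w = push l (foldr push v w)"
proof (cases v)
  case (Cons l' v')
  then show ?thesis
    using push_inv_letter[OF reduced_foldr_push[OF assms, of v']] by auto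
qed auto

lemma foldr_push_assoc:
  assumes "reduced w"
  shows "foldr push (foldr push u v) w = foldr push u (foldr push v w)"
  by (induction u) (auto simp: foldr_push_push[OF assms])

lemma foldr_push_reduced: "reduced w \<Longrightarrow> foldr push w [] = w"
proof (induction w)
  case (Cons l w)
  then show ?case using reduced_tl[OF Cons.prems] by (cases w) auto
qed auto

lemma foldr_push_inverse: "reduced w \<Longrightarrow> foldr push (map inv_letter (rev v)) (foldr push v w) = w"
  by (induction v arbitrary: w) (auto simp: push_inv_letter' reduced_foldr_push)

lemma F2_simps:
  "carrier F2 = {w. reduced w}" "u \<otimes>\<^bsub>F2\<^esub> v = foldr push u v" "\<one>\<^bsub>F2\<^esub> = []"
  by (simp_all add: F2_def)

lemma group_F2: "group F2"
proof (rule groupI)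
  fix w assume w: "w \<in> carrier F2"
  define v where "v = foldr push (map inv_letter (rev w)) []"
  have "foldr push v w = foldr push (map inv_letter (rev w)) (foldr push [] w)"
    unfolding v_def using w by (subst foldr_push_assoc) (auto simp: F2_simps)
  also have "\<dots> = foldr push (map inv_letter (rev w)) (foldr push w [])"
    using w by (simp add: F2_simps foldr_push_reduced)
  also have "\<dots> = []"
    by (simp add: foldr_push_inverse)
  finally show "\<exists>v\<in>carrier F2. v \<otimes>\<^bsub>F2\<^esub> w = \<one>\<^bsub>F2\<^esub>"
    using reduced_foldr_push[of "[]"] by (auto simp: F2_simps v_def)
qed (auto simp: F2_simps reduced_foldr_push foldr_push_assoc)

lemma gen_in_F2 [simp]: "gen_a \<in> carrier F2" "gen_b \<in> carrier F2"
  by (simp_all add: F2_simps gen_a_def gen_b_def)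

lemma inv_gen_F2: "inv\<^bsub>F2\<^esub> [(x, True)] = [(x, False)]"
  by (rule group.inv_equality[OF group_F2]) (auto simp: F2_simps inv_letter_def)

text \<open>The universal property: any two elements of a group are the images of the generators under
  exactly one homomorphism.\<close>

context
  fixes G :: "('c, 'd) monoid_scheme" (structure) and x y :: 'c
  assumes G: "group G" and xy: "x \<in> carrier G" "y \<in> carrier G"
begin

interpretation G: group G by (rule G)

definition letter_val :: "f2_gen \<times> bool \<Rightarrow> 'c" where
  "letter_val l = (let g = (case fst l of Gen_a \<Rightarrow> x | Gen_b \<Rightarrow> y) in if snd l then g else inv g)"

definition word_val :: "f2_word \<Rightarrow> 'c" where
  "word_val w = foldr (\<lambda>l r. letter_val l \<otimes> r) w \<one>"

lemma letter_val_closed: "letter_val l \<in> carrier G"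
  using xy by (auto simp: letter_val_def Let_def split: f2_gen.splits)

lemma word_val_closed: "word_val w \<in> carrier G"
  by (induction w) (auto simp: word_val_def letter_val_closed)

lemma letter_val_inv: "letter_val (inv_letter l) = inv (letter_val l)"
  using xy by (auto simp: letter_val_def inv_letter_def Let_def split: f2_gen.splits)

lemma word_val_push: "word_val (push l w) = letter_val l \<otimes> word_val w"
proof (cases w)
  case (Cons l' w')
  have "letter_val l \<otimes> (inv (letter_val l) \<otimes> word_val w') = word_val w'"
    using G.m_assoc[of "letter_val l" "inv (letter_val l)" "word_val w'"]
    by (simp add: letter_val_closed word_val_closed)
  with Cons show ?thesis
    by (auto simp: letter_val_inv word_val_def)
qed (simp add: word_val_def)

lemma word_val_hom: "word_val \<in> hom F2 G"
proof (rule homI)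
  fix u v assume "u \<in> carrier F2" "v \<in> carrier F2"
  have "word_val (foldr push u v) = word_val u \<otimes> word_val v"
  proof (induction u)
    case Nil
    then show ?case using word_val_closed[of v] by (simp add: word_val_def[of "[]"])
  next
    case (Cons l u)
    then show ?case
      using word_val_closed letter_val_closed
      by (simp add: word_val_push) (simp add: word_val_def G.m_assoc)
  qed
  then show "word_val (u \<otimes>\<^bsub>F2\<^esub> v) = word_val u \<otimes> word_val v"
    by (simp add: F2_simps)
qed (rule word_val_closed)

lemma F2_universal:
  "\<exists>\<phi> \<in> hom F2 G. \<phi> gen_a = x \<and> \<phi> gen_b = y \<and>
     (\<forall>\<psi> \<in> hom F2 G. \<psi> gen_a = x \<longrightarrow> \<psi> gen_b = y \<longrightarrow> (\<forall>w \<in> carrier F2. \<psi> w = \<phi> w))"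
proof (intro bexI[OF _ word_val_hom] conjI ballI impI)
  show "word_val gen_a = x" "word_val gen_b = y"
    using xy by (auto simp: word_val_def gen_a_def gen_b_def letter_val_def)
next
  fix \<psi> w assume \<psi>: "\<psi> \<in> hom F2 G" "\<psi> gen_a = x" "\<psi> gen_b = y" and w: "w \<in> carrier F2"
  interpret \<psi>: group_hom F2 G \<psi>
    using \<psi>(1) group_F2 G by (simp add: group_hom_def group_hom_axioms_def)
  have letter: "\<psi> [l] = letter_val l" for l
  proof -
    obtain g s where l: "l = (g, s)" by (cases l)
    have pos: "\<psi> [(g, True)] = (case g of Gen_a \<Rightarrow> x | Gen_b \<Rightarrow> y)"
      using \<psi> by (auto simp: gen_a_def gen_b_def split: f2_gen.splits)
    have "\<psi> (inv\<^bsub>F2\<^esub> [(g, True)]) = inv (\<psi> [(g, True)])"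
      by (rule \<psi>.hom_inv) (simp add: F2_simps)
    with pos show ?thesis
      by (cases s) (auto simp: l letter_val_def inv_gen_F2)
  qed
  from w have "reduced w" by (simp add: F2_simps)
  then show "\<psi> w = word_val w"
  proof (induction w)
    case Nil
    then show ?case using \<psi>.hom_one by (simp add: F2_simps word_val_def)
  next
    case (Cons l w)
    have "[l] \<otimes>\<^bsub>F2\<^esub> w = l # w"
      using Cons.prems by (cases w) (auto simp: F2_simps)
    moreover have "\<psi> ([l] \<otimes>\<^bsub>F2\<^esub> w) = \<psi> [l] \<otimes> \<psi> w"
      using Cons.prems by (intro \<psi>.hom_mult) (auto simp: F2_simps dest: reduced_tl)
    ultimately show ?case
      using Cons.IH[OF reduced_tl[OF Cons.prems]] by (simp add: letter word_val_def)
  qed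
qed

end

lemma P4_normal: "P4 \<lhd> F2"
proof -
  interpret group F2 by (rule group_F2)
  have prim_closed: "x \<in> carrier F2" if "primitive x" for x
    using that by (auto simp: primitive_def)
  show ?thesis
    unfolding P4_def
  proof (rule normal_generateI)
    show "{x [^]\<^bsub>F2\<^esub> (4::nat) | x. primitive x} \<subseteq> carrier F2"
      using prim_closed by auto
  next
    fix h g assume "h \<in> {x [^]\<^bsub>F2\<^esub> (4::nat) | x. primitive x}" and g: "g \<in> carrier F2"
    then obtain x where h: "h = x [^]\<^bsub>F2\<^esub> (4::nat)" and x: "primitive x" by auto
    define c where "c = (\<lambda>z. g \<otimes>\<^bsub>F2\<^esub> z \<otimes>\<^bsub>F2\<^esub> inv\<^bsub>F2\<^esub> g)"
    have "c \<in> hom F2 F2"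
      by (rule homI) (use g in \<open>auto simp: c_def m_assoc inv_solve_left\<close>)
    then interpret c: group_hom F2 F2 c
      by unfold_locales
    have inj: "inj_on c (carrier F2)"
      using g by (auto simp: inj_on_def c_def)
    have surj: "c ` carrier F2 = carrier F2"
    proof (intro equalityI subsetI)
      fix z assume z: "z \<in> carrier F2"
      have "z = c (inv\<^bsub>F2\<^esub> g \<otimes>\<^bsub>F2\<^esub> z \<otimes>\<^bsub>F2\<^esub> g)"
        using g z by (simp add: c_def m_assoc) (simp add: m_assoc[symmetric])
      then show "z \<in> c ` carrier F2" using g z by blast
    qed auto
    from x obtain S where S: "S \<subseteq> carrier F2" "card S = 2" "generate F2 S = carrier F2" "x \<in> S"
      by (auto simp: primitive_def)
    have "primitive (c x)"
      unfolding primitive_def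
    proof (intro exI[of _ "c ` S"] conjI)
      show "card (c ` S) = 2"
        using S inj by (simp add: card_image inj_on_subset)
      show "generate F2 (c ` S) = carrier F2"
        using S surj by (simp add: c.generate_img)
    qed (use S c.hom_closed in auto)
    moreover have "c h = c x [^]\<^bsub>F2\<^esub> (4::nat)"
      using prim_closed[OF x] by (simp add: h c.hom_nat_pow)
    ultimately show "g \<otimes>\<^bsub>F2\<^esub> h \<otimes>\<^bsub>F2\<^esub> inv\<^bsub>F2\<^esub> g \<in> {x [^]\<^bsub>F2\<^esub> (4::nat) | x. primitive x}"
      unfolding c_def by auto
  qed
qed

lemma group_GL: "group (GL n)"
  unfolding GL_def by (intro monoid.units_group ring.is_monoid ring_mat)

lemma GL_I:
  assumes "X \<in> carrier_mat n n" "Y \<in> carrier_mat n n" "X * Y = 1\<^sub>m n" "Y * X = 1\<^sub>m n"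
  shows "X \<in> carrier (GL n)"
  using assms by (auto simp: GL_def units_of_def Units_def ring_mat_def)

lemma mat_mult_upt:
  assumes "i < n" "j < n" "dim_row X = n" "dim_col X = n" "dim_row Y = n" "dim_col Y = n"
  shows "(X * Y) $$ (i, j) = (\<Sum>k\<leftarrow>[0..<n]. X $$ (i, k) * Y $$ (k, j) :: complex)"
  using assms by (simp add: scalar_prod_def interv_sum_list_conv_sum_set_nat)

lemma mat_mult_eq_oneI:
  fixes X Y :: "complex mat"
  assumes "X \<in> carrier_mat n n" "Y \<in> carrier_mat n n"
    and "\<forall>i\<in>set [0..<n]. \<forall>j\<in>set [0..<n].
      (\<Sum>k\<leftarrow>[0..<n]. X $$ (i, k) * Y $$ (k, j)) = (if i = j then 1 else 0)"
  shows "X * Y = 1\<^sub>m n"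
  by (rule eq_matI) (use assms in \<open>auto simp del: index_mult_mat(1) simp: mat_mult_upt[where n = n]\<close>)

lemma rho_in_GL:
  "rho44_a \<in> carrier (GL 9)" "rho44_b \<in> carrier (GL 9)"
  "rho4_a \<in> carrier (GL 4)" "rho4_b \<in> carrier (GL 4)"
proof -
  have upt4: "[0..<4] = [0, 1, 2, 3::nat]" and upt9: "[0..<9] = [0, 1, 2, 3, 4, 5, 6, 7, 8::nat]"
    by (simp_all add: upt_conv_Cons)
  show "rho44_a \<in> carrier (GL 9)"
    by (rule GL_I[where Y = "mat_diag 9 (\<lambda>k. [1, -1, \<i>, \<i>, -1, 1, -\<i>, -\<i>, 1] ! k)"];
        (rule mat_mult_eq_oneI)?; (rule carrier_matI)?)
      (simp_all add: rho44_a_def mat_diag_def upt9)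
  show "rho44_b \<in> carrier (GL 9)"
    by (rule GL_I[where Y = "mat_of_rows_list 9
    [[0, 0, 0, 0, 0, 1, 0, -1, -1],
     [0, 0, 0, 0, -1, 0, 1, 0, 0],
     [0, 0, 0, 0, 0, 0, -1, 0, 0],
     [0, 0, 0, 0, 0, 0, 0, -1, -1],
     [0, -1, 0, 1, 0, 0, 0, 0, 0],
     [1, 0, -1, 0, 0, 0, 0, 0, 1],
     [0, 0, 1, 0, 0, 0, 0, 0, -1],
     [0, 0, 0, 1, 0, 0, 0, 0, 0],
     [0, 0, 0, 0, 0, 0, 0, 0, 1]]"];
        (rule mat_mult_eq_oneI)?; (rule carrier_matI)?)
      (simp_all add: rho44_b_def mat_of_rows_list_def upt9)
  show "rho4_a \<in> carrier (GL 4)"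
    by (rule GL_I[where Y = "mat_of_rows_list 4 [[-\<i>,0,0,0],[0,\<i>,0,0],[0,0,1,0],[0,0,0,1]]"];
        (rule mat_mult_eq_oneI)?; (rule carrier_matI)?)
      (simp_all add: rho4_a_def mat_of_rows_list_def upt4)
  show "rho4_b \<in> carrier (GL 4)"
    by (rule GL_I[where Y = "mat_of_rows_list 4
    [[0, -1, 0, 1],
     [1, 0, -1, 0],
     [0, 0, 1, 0],
     [0, 0, 0, 1]]"];
        (rule mat_mult_eq_oneI)?; (rule carrier_matI)?)
      (simp_all add: rho4_b_def mat_of_rows_list_def upt4)
qed

end

theory Submission
  imports Defs
begin

text \<open>
  Finitely many fourth powers suffice to define \<open>F\<^sub>2/P\<^sub>4\<close>: one for each of the six lines that
  the image of a primitive element in \<open>\<int>\<^sup>2\<close> can span modulo 4. Consider the six relations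
  \<open>a\<^sup>4 = b\<^sup>4 = (ab)\<^sup>4 = (ab\<inverse>)\<^sup>4 = (ab\<^sup>2)\<^sup>4 = (a\<^sup>2b)\<^sup>4 = 1\<close>. In any group, a pair that satisfies
  them (\<open>quartic_pair\<close>) keeps satisfying them when it is changed by a Nielsen move. The only
  move that is not immediate replaces \<open>a\<close> by \<open>ab\<close>, and there \<open>(ab)\<^sup>2b = (ab)\<^sup>-\<^sup>2b\<close> is a
  conjugate of \<open>(a\<^sup>2b)\<inverse>\<close>. By Nielsen's theorem (\<open>nielsen_rank_two\<close>) every two-element generating
  set of the free group arises from \<open>{a, b}\<close> by such moves. Hence a homomorphism kills \<open>P\<^sub>4\<close> as
  soon as the images of \<open>a\<close> and \<open>b\<close> satisfy the six relations, which is a finite computation for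
  both representations.

  Conversely, the six relations determine the structure of the group that they define. Write
  \<open>r = a\<^sup>2\<close>. The squares \<open>a\<^sup>2\<close>, \<open>b\<^sup>2\<close>, \<open>ab\<^sup>2a\<inverse>\<close>, \<open>(ab)\<^sup>2\<close>, \<open>(ba)\<^sup>2\<close> are involutions. One should
  think of them as point reflections, and of the products \<open>p, q, u, v\<close> of \<open>r\<close> with the other
  four as translations; \<open>r\<close> inverts each of them. Translations commute because certain products
  of three or five reflections are again involutions (\<open>involutionI\<close>); they are so because they
  are conjugates of squares of the six words or of their inverses. In this way \<open>p\<close> commutes with
  \<open>q\<close>, \<open>u\<close> commutes with \<open>v\<close>, and certain products of \<open>p, q\<close> commute with \<open>u\<close> or \<open>v\<close> and vice
  versa. A computation with these commutations shows that \<open>z = [a, b]\<^sup>2\<close> is central and that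
  every commutator of \<open>p\<close> or \<open>q\<close> with \<open>u\<close> or \<open>v\<close> is \<open>z\<close> or \<open>z\<inverse>\<close> (\<open>z_central\<close>, \<open>u_p\<close>). The five
  elements thus generate a group of Heisenberg type, and every element of the whole group has
  the form \<open>p\<^sup>i q\<^sup>j u\<^sup>k v\<^sup>l z\<^sup>m a\<^sup>s b\<^sup>t\<close> with \<open>t < 2\<close> (\<open>generate_normal_form\<close>).

  It remains to read the exponents off the matrices. On suitable coordinates the translations
  act as shears, and the shear coefficients add up under multiplication (\<open>shear\<close>). In the
  nine-dimensional representation two coordinates determine \<open>i, j, k, l\<close> and a third one, on
  which \<open>z\<close> acts with coefficient \<open>2\<i>\<close>, determines \<open>m\<close>; so its kernel is \<open>P\<^sub>4\<close>. The
  four-dimensional representation also determines \<open>i, j, k, l\<close> but sends \<open>z\<close> to the identity.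
  Its kernel modulo \<open>P\<^sub>4\<close> is therefore the infinite cyclic group generated by \<open>z\<close>, which is
  isomorphic to \<open>\<int>\<^sup>d\<close> only for \<open>d = 1\<close>.
\<close>

section \<open>Identities in groups\<close>

context group begin

lemma cancel [simp]: "\<lbrakk>x \<in> carrier G; y \<in> carrier G\<rbrakk> \<Longrightarrow> inv x \<otimes> (x \<otimes> y) = y"
  "\<lbrakk>x \<in> carrier G; y \<in> carrier G\<rbrakk> \<Longrightarrow> x \<otimes> (inv x \<otimes> y) = y"
  by (simp_all add: m_assoc[symmetric])

lemmas word_simps = m_assoc inv_mult_group

lemma pow4: "x \<in> carrier G \<Longrightarrow> x [^] (4::nat) = x \<otimes> (x \<otimes> (x \<otimes> x))"
  by (simp add: numeral_eq_Suc m_assoc)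

lemma square_eq_inverse_square:
  assumes "x \<in> carrier G" "x [^] (4::nat) = \<one>" shows "x \<otimes> x = inv x \<otimes> inv x"
proof -
  have "(x \<otimes> x) \<otimes> (x \<otimes> x) = \<one>" using assms by (simp add: pow4 m_assoc)
  then show ?thesis using assms(1) by (metis inv_equality inv_mult_group m_closed)
qed

lemma cube_eq_inverse:
  assumes "x \<in> carrier G" "x [^] (4::nat) = \<one>"
  shows "x \<otimes> (x \<otimes> x) = inv x"
  using square_eq_inverse_square[OF assms] assms(1) by simp

text \<open>These rules bring a power of an element of order four into one of the forms
  \<open>1, x, x\<^sup>2, x\<inverse>\<close>. Together with associativity and cancellation they decide the word problem of
  the free product of two cyclic groups of order four, so that the simplifier proves identities
  that need only \<open>a\<^sup>4 = b\<^sup>4 = 1\<close>.\<close>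
lemma order_four_rules:
  assumes x: "x \<in> carrier G" "x [^] (4::nat) = \<one>"
  shows "inv x \<otimes> inv x = x \<otimes> x" "x \<otimes> (x \<otimes> x) = inv x"
    "w \<in> carrier G \<Longrightarrow> inv x \<otimes> (inv x \<otimes> w) = x \<otimes> (x \<otimes> w)"
    "w \<in> carrier G \<Longrightarrow> x \<otimes> (x \<otimes> (x \<otimes> w)) = inv x \<otimes> w"
proof -
  show 1: "inv x \<otimes> inv x = x \<otimes> x" "x \<otimes> (x \<otimes> x) = inv x"
    using square_eq_inverse_square[OF x] cube_eq_inverse[OF x] by simp_all
  show "w \<in> carrier G \<Longrightarrow> inv x \<otimes> (inv x \<otimes> w) = x \<otimes> (x \<otimes> w)"
    using 1(1) x(1) by (metis inv_closed m_assoc)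
  show "w \<in> carrier G \<Longrightarrow> x \<otimes> (x \<otimes> (x \<otimes> w)) = inv x \<otimes> w"
    using 1(2) x(1) by (metis m_closed m_assoc)
qed

lemma pow4_conj: assumes "x \<in> carrier G" "g \<in> carrier G" "x [^] (4::nat) = \<one>"
  shows "(g \<otimes> x \<otimes> inv g) [^] (4::nat) = \<one>"
proof -
  have "x \<otimes> (x \<otimes> (x \<otimes> (x \<otimes> inv g))) = inv g"
    using assms pow4[of x] by (metis inv_closed l_one m_assoc m_closed)
  then show ?thesis using assms by (simp add: pow4 m_assoc)
qed

lemma pow4_inv: assumes "x \<in> carrier G" "x [^] (4::nat) = \<one>"
  shows "(inv x) [^] (4::nat) = \<one>"
  using assms by (simp add: nat_pow_inv)

lemma commute_inv: "x \<otimes> y = y \<otimes> x \<Longrightarrow> x \<in> carrier G \<Longrightarrow> y \<in> carrier G \<Longrightarrow> inv x \<otimes> y = y \<otimes> inv x"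
  by (metis inv_solve_left inv_solve_right m_assoc m_closed inv_closed)

lemma conj_mult: "x \<in> carrier G \<Longrightarrow> y \<in> carrier G \<Longrightarrow> g \<in> carrier G \<Longrightarrow>
  inv g \<otimes> (x \<otimes> y \<otimes> g) = (inv g \<otimes> (x \<otimes> g)) \<otimes> (inv g \<otimes> (y \<otimes> g))"
  by (simp add: m_assoc)

lemma conj_inv: "x \<in> carrier G \<Longrightarrow> g \<in> carrier G \<Longrightarrow>
  inv g \<otimes> (inv x \<otimes> g) = inv (inv g \<otimes> (x \<otimes> g))"
  by (simp add: word_simps)

lemma conj_fixed: "x \<in> carrier G \<Longrightarrow> g \<in> carrier G \<Longrightarrow> g \<otimes> x = x \<otimes> g \<Longrightarrow> inv g \<otimes> (x \<otimes> g) = x"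
  by (metis cancel(1))

lemma int_pow_shift:
  assumes "g \<otimes> x = y \<otimes> g" "g \<in> carrier G" "x \<in> carrier G" "y \<in> carrier G"
  shows "g \<otimes> x [^] (n::int) = y [^] n \<otimes> g"
proof -
  have nat: "g \<otimes> x [^] (k::nat) = y [^] k \<otimes> g" for k
  proof (induction k)
    case (Suc k)
    have "g \<otimes> x [^] Suc k = (g \<otimes> x [^] k) \<otimes> x" using assms by (simp add: m_assoc)
    also have "\<dots> = y [^] k \<otimes> (g \<otimes> x)" unfolding Suc using assms(2-4) by (simp add: m_assoc)
    also have "\<dots> = y [^] Suc k \<otimes> g" unfolding assms(1) using assms(2-4) by (simp add: m_assoc)
    finally show ?case .
  qed (use assms in simp)
  show ?thesis
  proof (cases n rule: int_cases2)
    case (nonneg k)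
    then show ?thesis using nat by (simp add: int_pow_int)
  next
    case (nonpos k)
    have "inv (y [^] k) \<otimes> (y [^] k \<otimes> g) \<otimes> inv (x [^] k) = inv (y [^] k) \<otimes> (g \<otimes> x [^] k) \<otimes> inv (x [^] k)"
      by (simp only: nat)
    then have "g \<otimes> inv (x [^] k) = inv (y [^] k) \<otimes> g"
      using assms(2-4) by (simp add: m_assoc)
    then show ?thesis using nonpos assms(2-4) by (simp add: int_pow_neg int_pow_int)
  qed
qed

text \<open>In a group of nilpotency class two the commutator is bilinear.\<close>
lemma int_pow_commutator:
  assumes "y \<otimes> x = x \<otimes> y \<otimes> z" "x \<otimes> z = z \<otimes> x" "y \<otimes> z = z \<otimes> y"
    "x \<in> carrier G" "y \<in> carrier G" "z \<in> carrier G"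
  shows "y [^] (k::int) \<otimes> x [^] (n::int) = x [^] n \<otimes> y [^] k \<otimes> z [^] (k * n)"
proof -
  have "x \<otimes> y \<otimes> z = (x \<otimes> z) \<otimes> y" using assms(3-6) by (simp add: m_assoc)
  then have "y \<otimes> x [^] n = (x \<otimes> z) [^] n \<otimes> y"
    using assms by (intro int_pow_shift) auto
  also have "\<dots> = x [^] n \<otimes> z [^] n \<otimes> y"
    using int_pow_mult_distrib[OF assms(2,4,6)] by simp
  also have "\<dots> = x [^] n \<otimes> (y \<otimes> z [^] n)"
    using assms int_pow_shift[OF assms(3,5,6,6)] by (simp add: m_assoc)
  finally have "x [^] n \<otimes> (y \<otimes> z [^] n) [^] k = y [^] k \<otimes> x [^] n"
    using assms by (intro int_pow_shift) auto
  also have "(y \<otimes> z [^] n) [^] k = y [^] k \<otimes> z [^] (n * k)"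
    using int_pow_mult_distrib[OF int_pow_shift[OF assms(3,5,6,6)]] assms(5,6) by (simp add: int_pow_pow)
  finally show ?thesis using assms by (simp add: m_assoc mult.commute)
qed

lemma pow4_conjI:
  assumes "x [^] (4::nat) = \<one>" "y \<otimes> g = g \<otimes> x" "x \<in> carrier G" "y \<in> carrier G" "g \<in> carrier G"
  shows "y [^] (4::nat) = \<one>"
proof -
  have "y = y \<otimes> g \<otimes> inv g" using assms(4,5) by (simp add: m_assoc)
  also have "\<dots> = g \<otimes> x \<otimes> inv g" by (simp only: assms(2))
  finally show ?thesis using pow4_conj[OF assms(3,5,1)] by simp
qed

lemma generate_mono_of_subset:
  assumes "S \<subseteq> generate G T" "T \<subseteq> carrier G" shows "generate G S \<subseteq> generate G T"
  using assms by (simp add: generate_subgroup_incl generate_is_subgroup)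

lemma generate_commute:
  assumes "g \<in> generate G S" "S \<subseteq> carrier G" "h \<in> carrier G" "\<And>s. s \<in> S \<Longrightarrow> s \<otimes> h = h \<otimes> s"
  shows "g \<otimes> h = h \<otimes> g"
  using assms(1)
proof (induction g rule: generate.induct)
  case (inv s)
  have s: "s \<in> carrier G" using inv assms(2) by auto
  have "inv s \<otimes> (s \<otimes> h) \<otimes> inv s = inv s \<otimes> (h \<otimes> s) \<otimes> inv s" using assms(4)[OF inv] by simp
  then show ?case using s assms(3) by (metis inv_closed inv_solve_left inv_solve_right m_assoc m_closed)
next
  case (eng g g')
  have "g \<in> carrier G" "g' \<in> carrier G" using eng(1,2) generate_incl[OF assms(2)] by auto
  then show ?case using eng.IH assms(3) by (metis m_assoc)
qed (use assms in auto)

end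

section \<open>Pairs that satisfy the six relations\<close>

text \<open>In \<open>\<int>\<^sup>2\<close> the six words become \<open>(1, 0)\<close>, \<open>(0, 1)\<close>, \<open>(1, 1)\<close>, \<open>(1, -1)\<close>, \<open>(1, 2)\<close>, \<open>(2, 1)\<close>,
  which represent the six points of the projective line over \<open>\<int>/4\<close>.\<close>
locale quartic_pair = group G for G (structure) +
  fixes a b
  assumes a_closed [simp]: "a \<in> carrier G" and b_closed [simp]: "b \<in> carrier G"
    and quart: "a [^] (4::nat) = \<one>" "b [^] (4::nat) = \<one>"
      "(a \<otimes> b) [^] (4::nat) = \<one>" "(a \<otimes> inv b) [^] (4::nat) = \<one>"
      "(a \<otimes> (b \<otimes> b)) [^] (4::nat) = \<one>" "((a \<otimes> a) \<otimes> b) [^] (4::nat) = \<one>"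
begin

lemmas a_rules [simp] = order_four_rules[OF a_closed quart(1)]
lemmas b_rules [simp] = order_four_rules[OF b_closed quart(2)]

text \<open>The involutions \<open>r\<close>, \<open>rp\<close>, \<open>rq\<close>, \<open>ru\<close>, \<open>rv\<close> are the squares of \<open>a\<close>, \<open>b\<close>, \<open>aba\<inverse>\<close>, \<open>ab\<close>,
  \<open>ba\<close>. They are chosen so that conjugation by \<open>a\<close> permutes \<open>p, q, u, v\<close> up to inversion. The
  element \<open>c\<close> is a loop around the puncture when the free group is the fundamental group of the
  once-punctured torus.\<close>
definition "r = a \<otimes> a"
definition "p = r \<otimes> (b \<otimes> b)"
definition "q = r \<otimes> (a \<otimes> (b \<otimes> (b \<otimes> inv a)))"
definition "u = r \<otimes> (a \<otimes> (b \<otimes> (a \<otimes> b)))"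
definition "v = r \<otimes> (b \<otimes> (a \<otimes> (b \<otimes> a)))"
definition "c = a \<otimes> (b \<otimes> (inv a \<otimes> inv b))"
definition "z = c \<otimes> c"

lemmas element_defs = r_def p_def q_def u_def v_def c_def z_def

lemma closed [simp]: "r \<in> carrier G" "p \<in> carrier G" "q \<in> carrier G" "u \<in> carrier G" "v \<in> carrier G"
  "c \<in> carrier G" "z \<in> carrier G"
  by (simp_all add: element_defs)

lemma abab: "a \<otimes> (b \<otimes> (a \<otimes> b)) = inv b \<otimes> (inv a \<otimes> (inv b \<otimes> inv a))"
  using square_eq_inverse_square[OF _ quart(3)] by (simp add: word_simps)

lemma r_invol [simp]: "r \<otimes> r = \<one>" "inv r = r"  "x \<in> carrier G \<Longrightarrow> r \<otimes> (r \<otimes> x) = x"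
  by (simp_all add: element_defs word_simps)

lemma r_inverts:
  "r \<otimes> p = inv p \<otimes> r" "r \<otimes> q = inv q \<otimes> r" "r \<otimes> u = inv u \<otimes> r" "r \<otimes> v = inv v \<otimes> r"
proof -
  show "r \<otimes> p = inv p \<otimes> r" "r \<otimes> q = inv q \<otimes> r"
    by (simp_all add: element_defs word_simps)
  show "r \<otimes> u = inv u \<otimes> r"
    using abab by (simp add: element_defs word_simps)
  show "r \<otimes> v = inv v \<otimes> r"
    using arg_cong[OF abab, of "\<lambda>w. inv a \<otimes> (w \<otimes> a)"] by (simp add: element_defs word_simps)
qed

lemma r_past:
  assumes "x \<in> carrier G"
  shows "r \<otimes> (p \<otimes> x) = inv p \<otimes> (r \<otimes> x)" "r \<otimes> (q \<otimes> x) = inv q \<otimes> (r \<otimes> x)"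
    "r \<otimes> (u \<otimes> x) = inv u \<otimes> (r \<otimes> x)" "r \<otimes> (v \<otimes> x) = inv v \<otimes> (r \<otimes> x)"
  using r_inverts assms by (simp_all flip: m_assoc)

lemma shift_past_r: assumes "x \<in> carrier G" "r \<otimes> x = inv x \<otimes> r"
  shows "r \<otimes> inv x = x \<otimes> r" "y \<in> carrier G \<Longrightarrow> r \<otimes> (inv x \<otimes> y) = x \<otimes> (r \<otimes> y)"
proof -
  have "x \<otimes> (r \<otimes> x) \<otimes> inv x = x \<otimes> (inv x \<otimes> r) \<otimes> inv x" using assms by simp
  then show 1: "r \<otimes> inv x = x \<otimes> r" using assms(1) by (simp add: m_assoc)
  show "y \<in> carrier G \<Longrightarrow> r \<otimes> (inv x \<otimes> y) = x \<otimes> (r \<otimes> y)"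
    using 1 assms(1) by (simp flip: m_assoc)
qed

lemmas r_shift = r_inverts r_past
  shift_past_r[OF _ r_inverts(1), simplified] shift_past_r[OF _ r_inverts(2), simplified]
  shift_past_r[OF _ r_inverts(3), simplified] shift_past_r[OF _ r_inverts(4), simplified]

lemma a_conj: "a \<otimes> p = q \<otimes> a" "a \<otimes> q = inv p \<otimes> a" "a \<otimes> u = inv v \<otimes> a" "a \<otimes> v = u \<otimes> a"
proof -
  show "a \<otimes> p = q \<otimes> a" "a \<otimes> q = inv p \<otimes> a" "a \<otimes> v = u \<otimes> a"
    by (simp_all add: element_defs word_simps)
  show "a \<otimes> u = inv v \<otimes> a"
    using arg_cong[OF abab, of "\<lambda>w. inv a \<otimes> w"] by (simp add: element_defs word_simps)
qed

lemma shift_past_a: assumes "a \<otimes> x = y \<otimes> a" "x \<in> carrier G" "y \<in> carrier G"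
  shows "a \<otimes> inv x = inv y \<otimes> a" "w \<in> carrier G \<Longrightarrow> a \<otimes> (x \<otimes> w) = y \<otimes> (a \<otimes> w)"
   "w \<in> carrier G \<Longrightarrow> a \<otimes> (inv x \<otimes> w) = inv y \<otimes> (a \<otimes> w)"
proof -
  have "inv y \<otimes> (a \<otimes> x) \<otimes> inv x = inv y \<otimes> (y \<otimes> a) \<otimes> inv x" using assms by simp
  then show 1: "a \<otimes> inv x = inv y \<otimes> a" using assms(2,3) by (simp add: m_assoc)
  show "w \<in> carrier G \<Longrightarrow> a \<otimes> (x \<otimes> w) = y \<otimes> (a \<otimes> w)"
   "w \<in> carrier G \<Longrightarrow> a \<otimes> (inv x \<otimes> w) = inv y \<otimes> (a \<otimes> w)"
    using 1 assms by (simp_all flip: m_assoc)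
qed

lemmas a_shift = a_conj shift_past_a[OF a_conj(1), simplified] shift_past_a[OF a_conj(2), simplified]
  shift_past_a[OF a_conj(3), simplified] shift_past_a[OF a_conj(4), simplified]

text \<open>The source of all commutation relations. If \<open>x\<close> is a product of some of the elements
  \<open>p, q, u, v\<close> and their inverses, then \<open>r x\<inverse> r\<close> is the same product read backwards, because \<open>r\<close>
  inverts every factor. So whenever \<open>xr\<close> is a conjugate of the square of an element of order
  four, hence an involution, the product \<open>x\<close> equals its own reversal.\<close>
lemma involutionI:
  assumes "x \<otimes> r = g \<otimes> (s \<otimes> s) \<otimes> inv g" "s [^] (4::nat) = \<one>" "s \<in> carrier G" "g \<in> carrier G" "x \<in> carrier G"
  shows "x = r \<otimes> (inv x \<otimes> r)"
proof -
  have "s \<otimes> (s \<otimes> (s \<otimes> (s \<otimes> inv g))) = inv g"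
    using assms(2,3,4) pow4[OF assms(3)] by (metis inv_closed l_one m_assoc m_closed)
  then have "(x \<otimes> r) \<otimes> (x \<otimes> r) = \<one>"
    unfolding assms(1) using assms(2-5) by (simp add: m_assoc)
  then have "inv (x \<otimes> r) = x \<otimes> r" using assms(5) by (simp add: inv_equality)
  then have "r \<otimes> inv x = x \<otimes> r" using assms(5) by (simp add: word_simps)
  then have "r \<otimes> inv x \<otimes> r = x \<otimes> r \<otimes> r" by simp
  then show ?thesis using assms(5) by (simp add: m_assoc)
qed

text \<open>Here \<open>pqr\<close> is conjugate to \<open>(a\<inverse>b\<^sup>2)\<^sup>2\<close>.\<close>
lemma p_q_commute: "p \<otimes> q = q \<otimes> p"
proof -
  have "(inv a \<otimes> (b \<otimes> b)) [^] (4::nat) = \<one>"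
    using pow4_conj[OF _ _ pow4_inv[OF _ quart(5)], of "b \<otimes> b"] by (simp add: word_simps)
  from involutionI[OF _ this, of "p \<otimes> q" "inv a"] show ?thesis
    by (simp add: element_defs word_simps)
qed

text \<open>Here \<open>uv\<inverse>r\<close> is conjugate to \<open>(bab)\<^sup>2\<close>, and \<open>bab\<close> is conjugate to \<open>ab\<^sup>2\<close>.\<close>
lemma u_v_commute: "u \<otimes> v = v \<otimes> u"
proof -
  have *: "(b \<otimes> (a \<otimes> b)) [^] (4::nat) = \<one>"
    using pow4_conj[OF _ _ quart(5), of "b"] by (simp add: word_simps)
  \<comment> \<open>writing \<open>v\<inverse>r\<close> as \<open>rv\<close> avoids the inverse of the word \<open>baba\<close>\<close>
  have "u \<otimes> inv v \<otimes> r = inv a \<otimes> (b \<otimes> (a \<otimes> b) \<otimes> (b \<otimes> (a \<otimes> b))) \<otimes> a"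
    unfolding m_assoc[OF closed(4) inv_closed[OF closed(5)] closed(1)] r_inverts(4)[symmetric]
    by (simp add: element_defs word_simps)
  from involutionI[OF _ *, of "u \<otimes> inv v" "inv a"] this
  have "u \<otimes> inv v = r \<otimes> (inv (u \<otimes> inv v) \<otimes> r)" by simp
  also have "\<dots> = inv v \<otimes> u" by (simp add: word_simps r_shift)
  finally have "v \<otimes> (u \<otimes> inv v) \<otimes> v = v \<otimes> (inv v \<otimes> u) \<otimes> v" by simp
  then show ?thesis by (simp add: m_assoc)
qed

text \<open>The relation for \<open>ab\<inverse>\<close> says that \<open>q\<inverse>up\<inverse>\<close> is a palindrome.\<close>
lemma u_commute: "u \<otimes> (inv p \<otimes> q) = inv p \<otimes> q \<otimes> u"
proof -
  have "inv q \<otimes> (u \<otimes> inv p) = r \<otimes> (inv (inv q \<otimes> (u \<otimes> inv p)) \<otimes> r)"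
    by (rule involutionI[OF _ quart(4), of _ \<one>]) (simp_all add: element_defs word_simps)
  also have "\<dots> = inv p \<otimes> (u \<otimes> inv q)" by (simp add: word_simps r_shift)
  finally have "q \<otimes> (inv q \<otimes> (u \<otimes> inv p)) \<otimes> q = q \<otimes> (inv p \<otimes> (u \<otimes> inv q)) \<otimes> q" by simp
  then have "u \<otimes> (inv p \<otimes> q) = (q \<otimes> inv p) \<otimes> u" by (simp add: m_assoc)
  then show ?thesis using commute_inv[OF p_q_commute] by simp
qed

text \<open>The relation for \<open>b\<inverse>a\<close> says that \<open>p\<inverse>vq\<close> is a palindrome.\<close>
lemma v_commute: "v \<otimes> (p \<otimes> q) = p \<otimes> q \<otimes> v"
proof -
  have *: "(inv b \<otimes> a) [^] (4::nat) = \<one>"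
    using pow4_conj[OF _ _ quart(4), of "inv b"] by (simp add: word_simps)
  have "inv p \<otimes> (v \<otimes> q) = r \<otimes> (inv (inv p \<otimes> (v \<otimes> q)) \<otimes> r)"
    by (rule involutionI[OF _ *, of _ \<one>]) (simp_all add: element_defs word_simps)
  also have "\<dots> = q \<otimes> (v \<otimes> inv p)" by (simp add: word_simps r_shift)
  finally have "p \<otimes> (inv p \<otimes> (v \<otimes> q)) \<otimes> p = p \<otimes> (q \<otimes> (v \<otimes> inv p)) \<otimes> p" by simp
  then have "v \<otimes> (q \<otimes> p) = (p \<otimes> q) \<otimes> v" by (simp add: m_assoc)
  then show ?thesis using p_q_commute by simp
qed

text \<open>The relation for \<open>ba\<^sup>2\<close> says that \<open>u\<inverse>pv\<inverse>\<close> is a palindrome.\<close>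
lemma p_commute: "p \<otimes> (u \<otimes> inv v) = u \<otimes> inv v \<otimes> p"
proof -
  have *: "(b \<otimes> (a \<otimes> a)) [^] (4::nat) = \<one>"
    using pow4_conj[OF _ _ quart(6), of "b"] by (simp add: word_simps)
  have "inv u \<otimes> p \<otimes> inv v \<otimes> r = inv u \<otimes> p \<otimes> (inv v \<otimes> r)" by (simp add: m_assoc)
  also have "\<dots> = (inv u \<otimes> r) \<otimes> (inv p \<otimes> v)" unfolding r_inverts(4)[symmetric] by (simp add: r_shift m_assoc)
  also have "\<dots> = a \<otimes> (b \<otimes> (a \<otimes> a) \<otimes> (b \<otimes> (a \<otimes> a))) \<otimes> inv a" unfolding r_inverts(3)[symmetric]
    by (simp add: element_defs word_simps)
  finally have "inv u \<otimes> p \<otimes> inv v = r \<otimes> (inv (inv u \<otimes> p \<otimes> inv v) \<otimes> r)"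
    by (rule involutionI[OF _ *]) simp_all
  also have "\<dots> = inv v \<otimes> (p \<otimes> inv u)" by (simp add: word_simps r_shift)
  finally have "u \<otimes> (inv u \<otimes> p \<otimes> inv v) \<otimes> u = u \<otimes> (inv v \<otimes> (p \<otimes> inv u)) \<otimes> u" by simp
  then have "p \<otimes> (inv v \<otimes> u) = (u \<otimes> inv v) \<otimes> p" by (simp add: m_assoc)
  then show ?thesis using commute_inv[OF u_v_commute[symmetric]] by simp
qed

lemma q_commute: "q \<otimes> (u \<otimes> v) = u \<otimes> v \<otimes> q"
proof -
  have "a \<otimes> (p \<otimes> (u \<otimes> inv v)) = a \<otimes> (u \<otimes> inv v \<otimes> p)" by (simp add: p_commute)
  then have "q \<otimes> (inv v \<otimes> inv u) \<otimes> a = inv v \<otimes> inv u \<otimes> q \<otimes> a"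
    by (simp add: a_shift m_assoc)
  then have "q \<otimes> (inv v \<otimes> inv u) = inv v \<otimes> inv u \<otimes> q" by simp
  then have "q \<otimes> inv (u \<otimes> v) = inv (u \<otimes> v) \<otimes> q" by (simp add: word_simps)
  from commute_inv[OF this[symmetric]] show ?thesis by simp
qed

section \<open>The central element\<close>

text \<open>The commutator \<open>z1\<close> of \<open>p\<close> and \<open>u\<close> turns out to be \<open>z\<inverse>\<close> (\<open>z1_eq\<close>). Until its centrality is
  known, its conjugates have to be kept apart.\<close>
definition "z1 = inv p \<otimes> (inv u \<otimes> (p \<otimes> u))"

lemma z1_closed [simp]: "z1 \<in> carrier G" by (simp add: z1_def)

lemma conj_u_p: "inv u \<otimes> (p \<otimes> u) = p \<otimes> z1" by (simp add: z1_def)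

lemma conj_v_p: "inv v \<otimes> (p \<otimes> v) = p \<otimes> z1"
proof -
  have "inv u \<otimes> (p \<otimes> (u \<otimes> inv v)) \<otimes> v = inv u \<otimes> (u \<otimes> inv v \<otimes> p) \<otimes> v" by (simp add: p_commute)
  then show ?thesis by (simp add: m_assoc conj_u_p)
qed

lemma conj_u_q: "inv u \<otimes> (q \<otimes> u) = q \<otimes> z1"
proof -
  have "q \<otimes> inv p = inv p \<otimes> q" using commute_inv[OF p_q_commute] by simp
  then have "u \<otimes> (q \<otimes> inv p) = q \<otimes> inv p \<otimes> u" using u_commute by simp
  then have "q \<otimes> inv p = inv u \<otimes> (q \<otimes> inv p \<otimes> u)"
    using conj_fixed[of "q \<otimes> inv p" u] by simp
  also have "\<dots> = (inv u \<otimes> (q \<otimes> u)) \<otimes> inv (p \<otimes> z1)"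
    by (subst conj_mult) (simp_all add: conj_inv conj_u_p)
  finally have "q \<otimes> inv p \<otimes> (p \<otimes> z1) = inv u \<otimes> (q \<otimes> u) \<otimes> inv (p \<otimes> z1) \<otimes> (p \<otimes> z1)" by simp
  then show ?thesis by (simp add: m_assoc)
qed

lemma conj_v_q: "inv v \<otimes> (q \<otimes> v) = inv z1 \<otimes> q"
proof -
  have "p \<otimes> q = inv v \<otimes> (p \<otimes> q \<otimes> v)"
    using conj_fixed[OF _ _ v_commute] by simp
  also have "\<dots> = p \<otimes> z1 \<otimes> (inv v \<otimes> (q \<otimes> v))"
    by (subst conj_mult) (simp_all add: conj_v_p)
  finally have "inv (p \<otimes> z1) \<otimes> (p \<otimes> q) = inv (p \<otimes> z1) \<otimes> (p \<otimes> z1 \<otimes> (inv v \<otimes> (q \<otimes> v)))" by simp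
  then show ?thesis by (simp add: word_simps)
qed

text \<open>Conjugating \<open>q\<close> by \<open>u\<close> and then by \<open>v\<close> gives \<open>q\<close> again, since \<open>uv\<close> commutes with \<open>q\<close>.\<close>
lemma conj_v_z1: "inv v \<otimes> (z1 \<otimes> v) = inv q \<otimes> (z1 \<otimes> q)"
proof -
  have "q = inv v \<otimes> (inv u \<otimes> (q \<otimes> u) \<otimes> v)"
    using conj_fixed[of q "u \<otimes> v"] q_commute by (simp add: word_simps)
  also have "\<dots> = inv z1 \<otimes> q \<otimes> (inv v \<otimes> (z1 \<otimes> v))"
    unfolding conj_u_q by (subst conj_mult) (simp_all add: conj_v_q)
  finally have "inv q \<otimes> (z1 \<otimes> q) = inv q \<otimes> (z1 \<otimes> (inv z1 \<otimes> q \<otimes> (inv v \<otimes> (z1 \<otimes> v))))" by simp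
  then show ?thesis by (simp add: m_assoc)
qed

lemma conj_u_v_z1: "inv u \<otimes> (z1 \<otimes> u) = inv v \<otimes> (z1 \<otimes> v)"
proof -
  have "inv (u \<otimes> v) \<otimes> (p \<otimes> (u \<otimes> v)) = inv (v \<otimes> u) \<otimes> (p \<otimes> (v \<otimes> u))" by (simp add: u_v_commute)
  then have "inv v \<otimes> (inv u \<otimes> (p \<otimes> u) \<otimes> v) = inv u \<otimes> (inv v \<otimes> (p \<otimes> v) \<otimes> u)"
    by (simp add: word_simps)
  then have "p \<otimes> z1 \<otimes> (inv v \<otimes> (z1 \<otimes> v)) = p \<otimes> z1 \<otimes> (inv u \<otimes> (z1 \<otimes> u))"
    by (simp add: conj_u_p conj_v_p conj_mult)
  then show ?thesis by simp
qed

text \<open>Conjugation by \<open>u\<close> turns \<open>pq = qp\<close> into \<open>(p z1)(q z1) = (q z1)(p z1)\<close>, so \<open>pq\<inverse>\<close> commutes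
  with \<open>z1\<close>: conjugation by \<open>p\<close> and by \<open>q\<close> has the same effect on it.\<close>
lemma z1_conj_p_q: "p \<otimes> (inv q \<otimes> z1) = z1 \<otimes> (p \<otimes> inv q)" "q \<otimes> (z1 \<otimes> inv q) = p \<otimes> (z1 \<otimes> inv p)"
  "inv q \<otimes> (z1 \<otimes> q) = inv p \<otimes> (z1 \<otimes> p)"
proof -
  have "inv u \<otimes> (p \<otimes> q \<otimes> u) = inv u \<otimes> (q \<otimes> p \<otimes> u)" by (simp add: p_q_commute)
  then have "(p \<otimes> z1) \<otimes> (q \<otimes> z1) = (q \<otimes> z1) \<otimes> (p \<otimes> z1)"
    by (simp only: conj_mult closed b_closed conj_u_p conj_u_q)
  then have "(p \<otimes> z1 \<otimes> q) \<otimes> z1 = (q \<otimes> z1 \<otimes> p) \<otimes> z1" by (simp add: m_assoc)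
  then have "p \<otimes> z1 \<otimes> q = q \<otimes> z1 \<otimes> p" by simp
  then have "inv q \<otimes> (p \<otimes> z1 \<otimes> q) \<otimes> inv q = inv q \<otimes> (q \<otimes> z1 \<otimes> p) \<otimes> inv q" by simp
  then have 1: "inv q \<otimes> (p \<otimes> z1) = z1 \<otimes> (p \<otimes> inv q)" by (simp add: m_assoc)
  have 2: "inv q \<otimes> p = p \<otimes> inv q" using commute_inv[OF p_q_commute[symmetric]] by simp
  show 3: "p \<otimes> (inv q \<otimes> z1) = z1 \<otimes> (p \<otimes> inv q)" using 1 2 by (metis closed inv_closed m_assoc z1_closed)
  have "q \<otimes> (inv q \<otimes> (p \<otimes> z1)) \<otimes> inv p = q \<otimes> (z1 \<otimes> (p \<otimes> inv q)) \<otimes> inv p" by (simp only: 1)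
  then show "q \<otimes> (z1 \<otimes> inv q) = p \<otimes> (z1 \<otimes> inv p)"
    using arg_cong[OF 2, of "\<lambda>w. w \<otimes> inv p"] by (simp add: m_assoc)
  have "inv p \<otimes> (p \<otimes> (inv q \<otimes> z1)) \<otimes> q = inv p \<otimes> (z1 \<otimes> (p \<otimes> inv q)) \<otimes> q" by (simp only: 3)
  then show "inv q \<otimes> (z1 \<otimes> q) = inv p \<otimes> (z1 \<otimes> p)" by (simp add: m_assoc)
qed

text \<open>In terms of reflections \<open>c\<close> is the product \<open>(rq) \<cdot> r \<cdot> (rv)\<close> of three, so its square is a
  commutator of translations. The conjugate of \<open>c\<close> by \<open>b\<close> is such a product as well, now for \<open>v\<close>
  and \<open>p\<close>. This links \<open>z\<close>, which commutes with \<open>c\<close>, to the commutators of translations.\<close>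
lemma c_eq: "c = inv q \<otimes> (r \<otimes> v)"
  using arg_cong[OF abab, of "\<lambda>w. b \<otimes> (w \<otimes> a)"]
  by (simp add: element_defs word_simps)

lemma z_eq: "z = inv q \<otimes> (inv v \<otimes> (q \<otimes> v))"
  by (simp add: z_def c_eq m_assoc r_shift)

lemma b_conj_c: "b \<otimes> (c \<otimes> inv b) = r \<otimes> (v \<otimes> p)"
  by (simp add: element_defs word_simps)

lemma b_conj_z: "b \<otimes> (z \<otimes> inv b) = inv z1"
proof -
  have "b \<otimes> (z \<otimes> inv b) = (b \<otimes> (c \<otimes> inv b)) \<otimes> (b \<otimes> (c \<otimes> inv b))"
    by (simp add: z_def m_assoc)
  also have "\<dots> = inv v \<otimes> (inv p \<otimes> (v \<otimes> p))"
    unfolding b_conj_c by (simp add: m_assoc r_shift)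
  also have "\<dots> = inv (inv v \<otimes> (p \<otimes> v)) \<otimes> p" by (simp add: word_simps)
  also have "\<dots> = inv z1" unfolding conj_v_p by (simp add: word_simps)
  finally show ?thesis .
qed

lemma inv_z_eq: "inv z = inv q \<otimes> (z1 \<otimes> q)"
  unfolding z_eq conj_v_q by (simp add: word_simps)

text \<open>Apply \<open>c = q\<inverse>rv\<close> to its own square: conjugation by \<open>v\<close> sends \<open>z\<inverse>\<close> to \<open>z1\<close>, and conjugation
  by \<open>q\<inverse>\<close> sends \<open>z1\<close> back to \<open>z\<inverse>\<close>, so \<open>r\<close> in the middle has to fix \<open>z1\<close>.\<close>
lemma r_z1: "r \<otimes> z1 = z1 \<otimes> r"
proof -
  have 1: "v \<otimes> (inv z \<otimes> inv v) = z1" unfolding inv_z_eq conj_v_z1[symmetric] by (simp add: m_assoc)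
  have "inv z = c \<otimes> (inv z \<otimes> inv c)" by (simp add: z_def word_simps)
  also have "\<dots> = inv q \<otimes> (r \<otimes> (v \<otimes> (inv z \<otimes> inv v)) \<otimes> r) \<otimes> q"
    unfolding c_eq by (simp add: word_simps)
  also have "\<dots> = inv q \<otimes> (r \<otimes> z1 \<otimes> r) \<otimes> q" by (simp only: 1)
  finally have "q \<otimes> (inv q \<otimes> (z1 \<otimes> q)) \<otimes> inv q \<otimes> r = q \<otimes> (inv q \<otimes> (r \<otimes> z1 \<otimes> r) \<otimes> q) \<otimes> inv q \<otimes> r"
    unfolding inv_z_eq by simp
  then show ?thesis by (simp add: m_assoc)
qed

text \<open>Conjugation by \<open>b\<close> and by \<open>b\<^sup>2 = rp\<close> have the same effect on \<open>z\<close>, namely \<open>z1\<inverse>\<close>. Hence \<open>b\<close>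
  fixes \<open>z\<close>, so that \<open>z = z1\<inverse>\<close>.\<close>
lemma z1_eq: "z1 = inv z"
proof -
  have "p \<otimes> (inv z \<otimes> inv p) = z1" unfolding inv_z_eq z1_conj_p_q(3) by (simp add: m_assoc)
  then have 1: "p \<otimes> (z \<otimes> inv p) = inv z1" using conj_inv[of "inv z" "inv p"]
    by simp
  have "b \<otimes> (b \<otimes> (z \<otimes> inv b) \<otimes> inv b) = r \<otimes> (p \<otimes> (z \<otimes> inv p)) \<otimes> r"
    by (simp add: p_def word_simps)
  also have "\<dots> = r \<otimes> inv z1 \<otimes> r" by (simp add: 1)
  also have "\<dots> = inv z1" using commute_inv[OF r_z1[symmetric]] by (simp add: m_assoc)
  finally have "b \<otimes> (b \<otimes> (z \<otimes> inv b) \<otimes> inv b) = b \<otimes> (z \<otimes> inv b)" by (simp add: b_conj_z)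
  then have "inv b \<otimes> (b \<otimes> (b \<otimes> (z \<otimes> inv b) \<otimes> inv b)) = inv b \<otimes> (b \<otimes> (z \<otimes> inv b))" by (simp only:)
  then have "b \<otimes> (z \<otimes> inv b) \<otimes> inv b = z \<otimes> inv b" by simp
  then have "b \<otimes> (z \<otimes> inv b) = z" by (subst (asm) right_cancel) simp_all
  then have "z = inv z1" by (simp only: b_conj_z)
  then have "inv z = inv (inv z1)" by (simp only:)
  then show ?thesis unfolding inv_inv[OF z1_closed] by (rule sym)
qed

lemma z_central: "p \<otimes> z = z \<otimes> p" "q \<otimes> z = z \<otimes> q" "u \<otimes> z = z \<otimes> u" "v \<otimes> z = z \<otimes> v"
  "a \<otimes> z = z \<otimes> a" "b \<otimes> z = z \<otimes> b"
proof -
  have z: "z = inv z1" by (simp add: z1_eq)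
  have conjD: "g \<otimes> z = z \<otimes> g" if "inv g \<otimes> (inv z \<otimes> g) = inv z" "g \<in> carrier G" for g
  proof -
    have "g \<otimes> (inv g \<otimes> (inv z \<otimes> g)) = g \<otimes> inv z" by (simp only: that(1))
    then have "inv z \<otimes> g = g \<otimes> inv z" using that(2) by simp
    from commute_inv[OF this] show ?thesis using that(2) by simp
  qed
  have q: "inv q \<otimes> (inv z \<otimes> q) = inv z" using inv_z_eq unfolding z1_eq by (rule sym)
  then show "q \<otimes> z = z \<otimes> q" by (rule conjD) simp
  have "inv p \<otimes> (inv z \<otimes> p) = inv z" using q z1_conj_p_q(3) unfolding z1_eq by (simp only:)
  then show 2: "p \<otimes> z = z \<otimes> p" by (rule conjD) simp
  have v: "inv v \<otimes> (inv z \<otimes> v) = inv z" using q conj_v_z1 unfolding z1_eq by (simp only:)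
  then show "v \<otimes> z = z \<otimes> v" by (rule conjD) simp
  have "inv u \<otimes> (inv z \<otimes> u) = inv z" using v conj_u_v_z1 unfolding z1_eq by (simp only:)
  then show "u \<otimes> z = z \<otimes> u" by (rule conjD) simp
  have "b \<otimes> (z \<otimes> inv b) \<otimes> b = z \<otimes> b" by (simp only: b_conj_z z[symmetric])
  then show "b \<otimes> z = z \<otimes> b" by (simp add: m_assoc)
  have "a \<otimes> z = p \<otimes> (inv (inv u \<otimes> (p \<otimes> u))) \<otimes> a"
    by (simp add: z_eq a_shift word_simps)
  also have "\<dots> = p \<otimes> z \<otimes> inv p \<otimes> a" unfolding conj_u_p z1_eq by (simp add: word_simps)
  also have "\<dots> = z \<otimes> a" unfolding 2 by (simp add: m_assoc)
  finally show "a \<otimes> z = z \<otimes> a" .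
qed

end

section \<open>Normal forms\<close>

context quartic_pair begin

definition nf :: "int \<Rightarrow> int \<Rightarrow> int \<Rightarrow> int \<Rightarrow> int \<Rightarrow> 'a" where
  "nf i j k l m = p [^] i \<otimes> (q [^] j \<otimes> (u [^] k \<otimes> (v [^] l \<otimes> z [^] m)))"

lemma nf_closed [simp]: "nf i j k l m \<in> carrier G"
  by (simp add: nf_def)

lemma u_p: "u \<otimes> p = p \<otimes> u \<otimes> z" and v_p: "v \<otimes> p = p \<otimes> v \<otimes> z"
  and u_q: "u \<otimes> q = q \<otimes> u \<otimes> z" and v_q: "v \<otimes> q = q \<otimes> v \<otimes> inv z"
proof -
  have 1: "g \<otimes> x = x \<otimes> g \<otimes> z"
    if "inv g \<otimes> (x \<otimes> g) = x \<otimes> inv z" "g \<otimes> z = z \<otimes> g" "x \<in> carrier G" "g \<in> carrier G" for x g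
  proof -
    have "g \<otimes> (inv g \<otimes> (x \<otimes> g)) \<otimes> z = g \<otimes> (x \<otimes> inv z) \<otimes> z" by (simp only: that(1))
    then show ?thesis using that(3,4) by (simp add: m_assoc)
  qed
  show "u \<otimes> p = p \<otimes> u \<otimes> z" using conj_u_p z1_eq z_central by (intro 1) auto
  show "v \<otimes> p = p \<otimes> v \<otimes> z" using conj_v_p z1_eq z_central by (intro 1) auto
  show "u \<otimes> q = q \<otimes> u \<otimes> z" using conj_u_q z1_eq z_central by (intro 1) auto
  have "v \<otimes> (inv v \<otimes> (q \<otimes> v)) \<otimes> inv z = v \<otimes> (z \<otimes> q) \<otimes> inv z"
    unfolding conj_v_q z1_eq by simp
  then show "v \<otimes> q = q \<otimes> v \<otimes> inv z"
    unfolding z_central(2)[symmetric] by (simp add: m_assoc)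
qed

lemma z_pow_central:
  assumes "g \<in> carrier G" "g \<otimes> z = z \<otimes> g"
  shows "z [^] (m::int) \<otimes> g [^] (n::int) = g [^] n \<otimes> z [^] m"
    "w \<in> carrier G \<Longrightarrow> z [^] m \<otimes> (g [^] n \<otimes> w) = g [^] n \<otimes> (z [^] m \<otimes> w)"
proof -
  have "z [^] m \<otimes> g = g \<otimes> z [^] m" using int_pow_shift[OF assms(2,1)] assms by simp
  from int_pow_shift[OF this] show 1: "z [^] m \<otimes> g [^] n = g [^] n \<otimes> z [^] m"
    using assms by simp
  then show "w \<in> carrier G \<Longrightarrow> z [^] m \<otimes> (g [^] n \<otimes> w) = g [^] n \<otimes> (z [^] m \<otimes> w)"
    using assms by (simp flip: m_assoc)
qed

lemmas z_pow_shift = z_pow_central[OF _ z_central(1)] z_pow_central[OF _ z_central(2)]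
  z_pow_central[OF _ z_central(3)] z_pow_central[OF _ z_central(4)]

lemma pow_comm_shift:
  assumes "y [^] (k::int) \<otimes> x [^] (n::int) = x [^] n \<otimes> y [^] k \<otimes> s" "x \<in> carrier G" "y \<in> carrier G" "s \<in> carrier G"
  shows "w \<in> carrier G \<Longrightarrow> y [^] k \<otimes> (x [^] n \<otimes> w) = x [^] n \<otimes> (y [^] k \<otimes> (s \<otimes> w))"
  using assms by (simp flip: m_assoc)

lemma pow_commute:
  "u [^] (k::int) \<otimes> p [^] (n::int) = p [^] n \<otimes> u [^] k \<otimes> z [^] (k * n)"
  "v [^] (k::int) \<otimes> p [^] (n::int) = p [^] n \<otimes> v [^] k \<otimes> z [^] (k * n)"
  "u [^] (k::int) \<otimes> q [^] (n::int) = q [^] n \<otimes> u [^] k \<otimes> z [^] (k * n)"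
  "v [^] (k::int) \<otimes> q [^] (n::int) = q [^] n \<otimes> v [^] k \<otimes> z [^] (- (k * n))"
  "q [^] (k::int) \<otimes> p [^] (n::int) = p [^] n \<otimes> q [^] k"
  "v [^] (k::int) \<otimes> u [^] (n::int) = u [^] n \<otimes> v [^] k"
proof -
  show "u [^] (k::int) \<otimes> p [^] (n::int) = p [^] n \<otimes> u [^] k \<otimes> z [^] (k * n)"
    "v [^] (k::int) \<otimes> p [^] (n::int) = p [^] n \<otimes> v [^] k \<otimes> z [^] (k * n)"
    "u [^] (k::int) \<otimes> q [^] (n::int) = q [^] n \<otimes> u [^] k \<otimes> z [^] (k * n)"
    by (rule int_pow_commutator; simp add: u_p v_p u_q z_central)+
  show "v [^] (k::int) \<otimes> q [^] (n::int) = q [^] n \<otimes> v [^] k \<otimes> z [^] (- (k * n))"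
    using int_pow_commutator[OF v_q commute_inv[OF z_central(2)[symmetric], symmetric]
        commute_inv[OF z_central(4)[symmetric], symmetric], of k n]
    by (simp add: int_pow_inv int_pow_neg)
  show "q [^] (k::int) \<otimes> p [^] (n::int) = p [^] n \<otimes> q [^] k"
    using int_pow_commutator[of q p \<one> k n] p_q_commute by (simp add: int_pow_one)
  show "v [^] (k::int) \<otimes> u [^] (n::int) = u [^] n \<otimes> v [^] k"
    using int_pow_commutator[of v u \<one> k n] u_v_commute by (simp add: int_pow_one)
qed

lemma pow_shift: "x \<otimes> y = y' \<otimes> x' \<Longrightarrow> x \<in> carrier G \<Longrightarrow> y \<in> carrier G \<Longrightarrow>
    x' \<in> carrier G \<Longrightarrow> y' \<in> carrier G \<Longrightarrow> w \<in> carrier G \<Longrightarrow> x \<otimes> (y \<otimes> w) = y' \<otimes> (x' \<otimes> w)"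
  by (simp flip: m_assoc)

lemma pow_merge': "x \<in> carrier G \<Longrightarrow> x [^] (i::int) \<otimes> x [^] (j::int) = x [^] (i + j)"
  by (simp add: int_pow_mult)

lemma pow_merge: "x \<in> carrier G \<Longrightarrow> w \<in> carrier G \<Longrightarrow> x [^] (i::int) \<otimes> (x [^] (j::int) \<otimes> w) = x [^] (i + j) \<otimes> w"
  by (simp add: int_pow_mult flip: m_assoc)

text \<open>Collecting the factors produces powers of the central element \<open>z\<close>, according to the
  commutators of \<open>u, v\<close> with \<open>p, q\<close>; only \<open>v\<close> with \<open>q\<close> contributes with the opposite sign.\<close>
lemma nf_mult:
  "nf i j k l m \<otimes> nf i' j' k' l' m' =
    nf (i + i') (j + j') (k + k') (l + l') (m + m' + (k + l) * i' + (k - l) * j')"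
proof -
  note shifts = pow_comm_shift[OF pow_commute(1)] pow_comm_shift[OF pow_commute(2)]
      pow_comm_shift[OF pow_commute(3)] pow_comm_shift[OF pow_commute(4)]
      pow_shift[OF pow_commute(5)] pow_shift[OF pow_commute(6)]
  show ?thesis
    by (simp add: nf_def m_assoc z_pow_shift shifts pow_merge pow_merge' algebra_simps)
qed

text \<open>Since \<open>a\<close> permutes \<open>{p, q}\<close> and \<open>{u, v}\<close> up to inversion, and the elements of each set
  commute, no power of \<open>z\<close> appears.\<close>
lemma a_nf: "a \<otimes> nf i j k l m = nf (- j) i l (- k) m \<otimes> a"
proof -
  note a_pow = int_pow_shift[OF a_conj(1)] int_pow_shift[OF a_conj(2)] int_pow_shift[OF a_conj(3)]
    int_pow_shift[OF a_conj(4)] int_pow_shift[OF z_central(5)]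
  note a_pow' = a_pow[THEN pow_shift]
  have "a \<otimes> nf i j k l m = q [^] i \<otimes> (p [^] (-j) \<otimes> (v [^] (-k) \<otimes> (u [^] l \<otimes> z [^] m))) \<otimes> a"
    by (simp add: nf_def m_assoc a_pow a_pow' int_pow_inv int_pow_neg)
  also have "\<dots> = nf (- j) i l (- k) m \<otimes> a"
    by (simp add: nf_def pow_shift[OF pow_commute(5)] pow_shift[OF pow_commute(6)])
  finally show ?thesis .
qed

lemma a_pow_nf: "\<exists>i' j' k' l' m'. a [^] (s::nat) \<otimes> nf i j k l m = nf i' j' k' l' m' \<otimes> a [^] s"
proof (induction s arbitrary: i j k l m)
  case 0
  have "a [^] (0::nat) \<otimes> nf i j k l m = nf i j k l m \<otimes> a [^] (0::nat)" by simp
  then show ?case by blast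
next
  case (Suc s)
  obtain i' j' k' l' m' where *: "a [^] s \<otimes> nf (-j) i l (-k) m = nf i' j' k' l' m' \<otimes> a [^] s"
    using Suc.IH by blast
  have "a [^] Suc s \<otimes> nf i j k l m = (a [^] s \<otimes> nf (-j) i l (-k) m) \<otimes> a" by (simp add: m_assoc a_nf)
  also have "\<dots> = nf i' j' k' l' m' \<otimes> a [^] Suc s" by (simp add: * m_assoc)
  finally show ?case by blast
qed

text \<open>The exponent \<open>s\<close> is left unbounded; it matters only modulo 4.\<close>
definition normal_form :: "'a \<Rightarrow> bool" where
  "normal_form g \<longleftrightarrow> (\<exists>i j k l m s t. t < 2 \<and> g = nf i j k l m \<otimes> (a [^] (s::nat) \<otimes> b [^] (t::nat)))"

lemma b_square: "b \<otimes> b = nf (-1) 0 0 0 0 \<otimes> (a \<otimes> a)"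
proof -
  have "nf (-1) 0 0 0 0 = inv p" by (simp add: nf_def int_pow_neg)
  then show ?thesis by (simp add: p_def r_def word_simps)
qed

text \<open>In the quotient by the translations and \<open>z\<close> this is the relation \<open>ba = a\<inverse>b\<close> of the
  quaternion group.\<close>
lemma b_a: "b \<otimes> a = nf 0 (-1) 0 (-1) (-1) \<otimes> (a [^] (3::nat) \<otimes> b)"
proof -
  have "nf 0 (-1) 0 (-1) (-1) = nf 0 0 0 (-1) 0 \<otimes> nf 0 (-1) 0 0 0" by (simp add: nf_mult)
  also have "\<dots> = inv v \<otimes> inv q" by (simp add: nf_def int_pow_neg)
  finally have 1: "nf 0 (-1) 0 (-1) (-1) = inv v \<otimes> inv q" .
  have 2: "a [^] (3::nat) = inv a" by (simp add: numeral_eq_Suc m_assoc)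
  have "inv v \<otimes> inv q \<otimes> (inv a \<otimes> b) = (inv v \<otimes> r) \<otimes> (r \<otimes> inv q \<otimes> inv a \<otimes> b)"
    by (simp add: m_assoc)
  also have "\<dots> = b \<otimes> a" unfolding r_inverts(4)[symmetric] by (simp add: element_defs word_simps)
  finally show ?thesis by (simp add: 1 2)
qed

lemma normal_form_a:
  assumes "normal_form g" shows "normal_form (g \<otimes> a)"
proof -
  obtain i j k l m s t where t: "t < 2" and g: "g = nf i j k l m \<otimes> (a [^] (s::nat) \<otimes> b [^] (t::nat))"
    using assms by (auto simp: normal_form_def)
  consider "t = 0" | "t = 1" using t by linarith
  then show ?thesis
  proof cases
    case 1
    then have "g \<otimes> a = nf i j k l m \<otimes> (a [^] Suc s \<otimes> b [^] (0::nat))"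
      by (simp add: g m_assoc)
    then show ?thesis unfolding normal_form_def by (metis zero_less_numeral)
  next
    case 2
    obtain i' j' k' l' m' where shift: "a [^] s \<otimes> nf 0 (-1) 0 (-1) (-1) = nf i' j' k' l' m' \<otimes> a [^] s"
      using a_pow_nf by blast
    have "g \<otimes> a = nf i j k l m \<otimes> (a [^] s \<otimes> (b \<otimes> a))"
      using 2 by (simp add: g m_assoc)
    also have "\<dots> = nf i j k l m \<otimes> ((a [^] s \<otimes> nf 0 (-1) 0 (-1) (-1)) \<otimes> (a [^] (3::nat) \<otimes> b))"
      by (simp add: b_a m_assoc)
    also have "\<dots> = (nf i j k l m \<otimes> nf i' j' k' l' m') \<otimes> (a [^] (s + 3) \<otimes> b [^] (1::nat))"
      by (simp add: shift m_assoc flip: nat_pow_mult)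
    finally show ?thesis unfolding normal_form_def nf_mult by (metis one_less_numeral_iff semiring_norm(76))
  qed
qed

lemma normal_form_b:
  assumes "normal_form g" shows "normal_form (g \<otimes> b)"
proof -
  obtain i j k l m s t where t: "t < 2" and g: "g = nf i j k l m \<otimes> (a [^] (s::nat) \<otimes> b [^] (t::nat))"
    using assms by (auto simp: normal_form_def)
  consider "t = 0" | "t = 1" using t by linarith
  then show ?thesis
  proof cases
    case 1
    then have "g \<otimes> b = nf i j k l m \<otimes> (a [^] s \<otimes> b [^] (1::nat))"
      by (simp add: g m_assoc)
    then show ?thesis unfolding normal_form_def by (metis one_less_numeral_iff semiring_norm(76))
  next
    case 2
    obtain i' j' k' l' m' where shift: "a [^] s \<otimes> nf (-1) 0 0 0 0 = nf i' j' k' l' m' \<otimes> a [^] s"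
      using a_pow_nf by blast
    have "g \<otimes> b = nf i j k l m \<otimes> (a [^] s \<otimes> (b \<otimes> b))"
      using 2 by (simp add: g m_assoc)
    also have "\<dots> = nf i j k l m \<otimes> ((a [^] s \<otimes> nf (-1) 0 0 0 0) \<otimes> (a \<otimes> a))"
      by (simp add: b_square m_assoc)
    also have "\<dots> = (nf i j k l m \<otimes> nf i' j' k' l' m') \<otimes> (a [^] (s + 2) \<otimes> b [^] (0::nat))"
      by (simp add: shift m_assoc numeral_eq_Suc)
    finally show ?thesis unfolding normal_form_def nf_mult by (metis zero_less_numeral)
  qed
qed

text \<open>The set of normal forms contains \<open>1\<close> and is closed under right multiplication by \<open>a\<close> and
  \<open>b\<close>, hence also by their inverses, which are third powers.\<close>
lemma generate_normal_form:
  assumes "g \<in> generate G {a, b}"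
  shows "normal_form g"
proof -
  have "normal_form (h \<otimes> g)" if "h \<in> carrier G" "normal_form h" for h
    using assms that
  proof (induction g arbitrary: h rule: generate.induct)
    case (incl x)
    then show ?case using normal_form_a normal_form_b by auto
  next
    case (inv x)
    have "h \<otimes> inv x = h \<otimes> x \<otimes> x \<otimes> x" using inv by (auto simp: m_assoc)
    moreover have "normal_form (h \<otimes> x \<otimes> x \<otimes> x)"
      using inv.hyps inv.prems(2) by (auto intro: normal_form_a normal_form_b)
    ultimately show ?case by simp
  next
    case (eng x y)
    have "generate G {a, b} \<subseteq> carrier G" by (rule generate_incl) simp
    with eng show ?case by (simp add: subset_iff flip: m_assoc)
  qed simp
  moreover have "\<one> = nf 0 0 0 0 0 \<otimes> (a [^] (0::nat) \<otimes> b [^] (0::nat))" by (simp add: nf_def)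
  then have "normal_form \<one>" unfolding normal_form_def by (metis zero_less_numeral)
  moreover have "g \<in> carrier G" using assms generate_incl[of "{a, b}"] by auto
  ultimately show ?thesis by (metis l_one one_closed)
qed

end

section \<open>Invariance of the six relations under Nielsen moves\<close>

context quartic_pair begin

lemma quartic_pair_swap: "quartic_pair G b a"
proof unfold_locales
  show "(b \<otimes> a) [^] (4::nat) = \<one>"
    by (rule pow4_conjI[OF quart(3), of _ b]) (simp_all add: m_assoc)
  show "(b \<otimes> inv a) [^] (4::nat) = \<one>"
    by (rule pow4_conjI[OF pow4_inv[OF _ quart(4)], of _ \<one>]) (simp_all add: word_simps)
  show "(b \<otimes> (a \<otimes> a)) [^] (4::nat) = \<one>"
    by (rule pow4_conjI[OF quart(6), of _ b]) (simp_all add: m_assoc)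
  show "(b \<otimes> b \<otimes> a) [^] (4::nat) = \<one>"
    by (rule pow4_conjI[OF quart(5), of _ "b \<otimes> b"]) (simp_all add: m_assoc)
qed (simp_all add: quart)

lemma quartic_pair_inv: "quartic_pair G (inv a) b"
proof unfold_locales
  show "(inv a) [^] (4::nat) = \<one>" using pow4_inv quart(1) by simp
  show "(inv a \<otimes> b) [^] (4::nat) = \<one>"
    by (rule pow4_conjI[OF pow4_inv[OF _ quart(4)], of _ "inv a"]) (simp_all add: word_simps)
  show "(inv a \<otimes> inv b) [^] (4::nat) = \<one>"
    by (rule pow4_conjI[OF pow4_inv[OF _ quart(3)], of _ "inv a"]) (simp_all add: word_simps)
  show "(inv a \<otimes> (b \<otimes> b)) [^] (4::nat) = \<one>"
    by (rule pow4_conjI[OF pow4_inv[OF _ quart(5)], of _ "inv a"]) (simp_all add: word_simps)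
  show "(inv a \<otimes> inv a \<otimes> b) [^] (4::nat) = \<one>"
    using quart(6) by simp
qed (simp_all add: quart)

text \<open>For the word \<open>(ab)\<^sup>2b\<close> use \<open>(ab)\<^sup>2 = (ab)\<^sup>-\<^sup>2\<close>; then \<open>b\<inverse>a\<inverse>b\<inverse>a\<inverse>b\<close> is a conjugate of
  \<open>(a\<^sup>2b)\<inverse>\<close>. The other words become, up to \<open>b\<^sup>4 = 1\<close>, words of the list.\<close>
lemma quartic_pair_mult: "quartic_pair G (a \<otimes> b) b"
proof unfold_locales
  show "(a \<otimes> b \<otimes> b) [^] (4::nat) = \<one>" using quart(5) by (simp add: m_assoc)
  show "(a \<otimes> b \<otimes> inv b) [^] (4::nat) = \<one>" using quart(1) by (simp add: m_assoc)
  show "(a \<otimes> b \<otimes> (b \<otimes> b)) [^] (4::nat) = \<one>" using quart(4) by (simp add: m_assoc)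
  show "(a \<otimes> b \<otimes> (a \<otimes> b) \<otimes> b) [^] (4::nat) = \<one>"
    using arg_cong[OF abab, of "\<lambda>w. w \<otimes> inv a"]
    by (intro pow4_conjI[OF pow4_inv[OF _ quart(6)], of _ "inv b \<otimes> inv a"]) (simp_all add: word_simps)
qed (simp_all add: quart)

lemma quartic_pair_hom:
  assumes "group H" "h \<in> hom G H"
  shows "quartic_pair H (h a) (h b)"
proof -
  interpret h: group_hom G H h
    using assms by (simp add: group_hom_def group_hom_axioms_def is_group)
  have *: "h x [^]\<^bsub>H\<^esub> (4::nat) = \<one>\<^bsub>H\<^esub>" if "x [^] (4::nat) = \<one>" "x \<in> carrier G" for x
    using that by (metis h.hom_nat_pow h.hom_one)
  show ?thesis
    using *[OF quart(1)] *[OF quart(2)] *[OF quart(3)] *[OF quart(4)] *[OF quart(5)] *[OF quart(6)]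
    by unfold_locales simp_all
qed

lemma quartic_pair_conj:
  assumes g: "g \<in> carrier G"
  shows "quartic_pair G (g \<otimes> a \<otimes> inv g) (g \<otimes> b \<otimes> inv g)"
  by (rule quartic_pair_hom[OF is_group, of "\<lambda>x. g \<otimes> x \<otimes> inv g"])
    (use g in \<open>auto simp: hom_def m_assoc\<close>)

end

section \<open>Nielsen's theorem in rank two\<close>

interpretation F2: group F2 by (rule group_F2)

definition winv :: "f2_word \<Rightarrow> f2_word" where "winv w = map inv_letter (rev w)"

lemma winv_simps [simp]: "winv [] = []" "winv (u @ v) = winv v @ winv u" "winv (l # w) = winv w @ [inv_letter l]"
  "length (winv w) = length w" "winv (winv w) = w"
  by (simp_all add: winv_def rev_map o_def)

lemma reduced_winv [simp]: "reduced (winv w) \<longleftrightarrow> reduced w"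
proof -
  have "successively (\<lambda>x y. inv_letter x \<noteq> y) w = successively (\<lambda>x y. y \<noteq> inv_letter x) w"
    by (rule successively_cong) auto
  then show ?thesis
    by (simp add: reduced_def winv_def successively_map successively_rev)
qed

lemma reduced_append: "reduced (u @ v) \<longleftrightarrow> reduced u \<and> reduced v \<and> (u \<noteq> [] \<longrightarrow> v \<noteq> [] \<longrightarrow> hd v \<noteq> inv_letter (last u))"
  by (auto simp: reduced_def successively_append_iff)

lemma reduced_append3: "reduced (u @ v) \<Longrightarrow> reduced (v @ w) \<Longrightarrow> v \<noteq> [] \<Longrightarrow> reduced (u @ v @ w)"
  by (auto simp: reduced_append)

lemma foldr_push_append: "reduced (u @ v) \<Longrightarrow> foldr push u v = u @ v"
  using foldr_push_assoc[of "[]" u v]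
proof (induction u)
  case (Cons l u)
  have "reduced (u @ v)" using Cons.prems(1) reduced_tl by simp
  then have "foldr push u v = u @ v" using Cons.IH foldr_push_assoc by auto
  then show ?case using Cons.prems(1) by (cases "u @ v") auto
qed simp

lemma inv_F2: "w \<in> carrier F2 \<Longrightarrow> inv\<^bsub>F2\<^esub> w = winv w"
  using foldr_push_inverse[of "[]" w]
  by (intro F2.inv_equality) (auto simp: F2_simps foldr_push_reduced winv_def[symmetric])

lemma length_inv_F2: "w \<in> carrier F2 \<Longrightarrow> length (inv\<^bsub>F2\<^esub> w) = length w"
  by (simp add: inv_F2)

text \<open>The word \<open>w\<close> is the part that cancels when \<open>u\<close> and \<open>v\<close> are multiplied.\<close>
lemma cancellation:
  assumes "u \<in> carrier F2" "v \<in> carrier F2"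
  obtains p w q where "u = p @ w" "v = winv w @ q" "u \<otimes>\<^bsub>F2\<^esub> v = p @ q" "reduced (p @ q)"
proof -
  have "\<exists>p w q. u = p @ w \<and> v = winv w @ q \<and> foldr push u v = p @ q"
    using assms(1) unfolding F2_simps mem_Collect_eq
  proof (induction u)
    case (Cons l u)
    then obtain p w q where *: "u = p @ w" "v = winv w @ q" "foldr push u v = p @ q"
      using reduced_tl by blast
    show ?case
    proof (cases p)
      case Nil
      show ?thesis
      proof (cases "q \<noteq> [] \<and> hd q = inv_letter l")
        case True
        then have "l # u = [] @ (l # u)" "v = winv (l # u) @ tl q" "foldr push (l # u) v = [] @ tl q"
          using * Nil by (cases q; simp)+
        then show ?thesis by blast
      next
        case False
        then have "l # u = [l] @ u" "v = winv u @ q" "foldr push (l # u) v = [l] @ q"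
          using * Nil by (cases q; simp)+
        then show ?thesis by blast
      qed
    next
      case (Cons l' p')
      then have "l # u = (l # p) @ w" "v = winv w @ q" "foldr push (l # u) v = (l # p) @ q"
        using * Cons.prems by auto
      then show ?thesis by blast
    qed
  qed simp
  then obtain p w q where "u = p @ w" "v = winv w @ q" "foldr push u v = p @ q" by blast
  moreover have "reduced (foldr push u v)" using assms reduced_foldr_push by (simp add: F2_simps)
  ultimately show ?thesis using that by (simp add: F2_simps)
qed

lemma length_mult_F2: "u \<in> carrier F2 \<Longrightarrow> v \<in> carrier F2 \<Longrightarrow> length (u \<otimes>\<^bsub>F2\<^esub> v) \<le> length u + length v"
  by (erule (1) cancellation) simp

text \<open>The number of letters lost in a product is twice the length of the part that cancels. The
  factor 2 is kept in order to compare it with lengths without division.\<close>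
definition lost :: "f2_word \<Rightarrow> f2_word \<Rightarrow> nat" where
  "lost u v = length u + length v - length (u \<otimes>\<^bsub>F2\<^esub> v)"

lemma cancellation_lost:
  assumes "u \<in> carrier F2" "v \<in> carrier F2"
  obtains p w q where "u = p @ w" "v = winv w @ q" "u \<otimes>\<^bsub>F2\<^esub> v = p @ q" "reduced (p @ q)" "lost u v = 2 * length w"
proof (rule cancellation[OF assms])
  fix p w q assume *: "u = p @ w" "v = winv w @ q" "u \<otimes>\<^bsub>F2\<^esub> v = p @ q" "reduced (p @ q)"
  have "lost u v = 2 * length w" unfolding lost_def *(3) using *(1,2) by simp
  then show thesis using * that by blast
qed

text \<open>If half of \<open>u\<close> cancelled in \<open>uu\<close>, then the letter at position \<open>i\<close> would be the inverse of
  the letter at the mirror position for every \<open>i\<close> in the first half. In the middle of the word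
  this makes a letter equal to its own inverse or puts two inverse letters next to each other.\<close>
lemma lost_self:
  assumes "u \<in> carrier F2" "u \<noteq> []"
  shows "lost u u < length u"
proof (rule ccontr)
  assume not_less: "\<not> lost u u < length u"
  obtain p w q where u: "u = p @ w" "u = winv w @ q" and "lost u u = 2 * length w"
    using cancellation_lost[OF assms(1,1)] by metis
  define n where "n = length u"
  \<comment> \<open>the middle position, or the left one of the two middle positions\<close>
  define i where "i = (n - 1) div 2"
  have n: "n > 0" "n \<le> 2 * length w" "length w \<le> n"
    using assms(2) not_less \<open>lost u u = _\<close> arg_cong[OF u(1), of length] by (auto simp: n_def)
  then have i: "i < length w" "i < n" by (auto simp: i_def)
  have "u ! i = winv w ! i" using i by (subst u(2)) (simp add: nth_append)
  also have "\<dots> = inv_letter (w ! (length w - 1 - i))"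
    using i by (simp add: winv_def rev_nth)
  also have "w ! (length w - 1 - i) = u ! (n - 1 - i)"
  proof -
    have "n - 1 - i = length p + (length w - 1 - i)"
      using i n arg_cong[OF u(1), of length] by (simp add: n_def)
    then show ?thesis by (simp add: u(1))
  qed
  finally have eq: "u ! i = inv_letter (u ! (n - 1 - i))" .
  have "n - 1 - i = i \<or> n - 1 - i = Suc i" using n(1) unfolding i_def by linarith
  then show False
  proof
    assume "n - 1 - i = i"
    then show False using eq by simp
  next
    assume 1: "n - 1 - i = Suc i"
    then have "Suc i < length u" unfolding n_def by linarith
    moreover have "reduced u" using assms(1) by (simp add: F2_simps)
    ultimately have "u ! Suc i \<noteq> inv_letter (u ! i)"
      unfolding reduced_def successively_conv_nth by blast
    then show False using eq 1 by simp
  qed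
qed

text \<open>Conjugation is included among the moves. It is what removes the tie in the length argument
  below, where the usual proof needs a well-ordering of the words.\<close>
inductive nielsen :: "f2_word \<Rightarrow> f2_word \<Rightarrow> bool" where
  base: "nielsen gen_a gen_b"
| swap: "nielsen x y \<Longrightarrow> nielsen y x"
| inv: "nielsen x y \<Longrightarrow> nielsen (inv\<^bsub>F2\<^esub> x) y"
| mult: "nielsen x y \<Longrightarrow> nielsen (x \<otimes>\<^bsub>F2\<^esub> y) y"
| conj: "nielsen x y \<Longrightarrow> g \<in> carrier F2 \<Longrightarrow>
    nielsen (g \<otimes>\<^bsub>F2\<^esub> x \<otimes>\<^bsub>F2\<^esub> inv\<^bsub>F2\<^esub> g) (g \<otimes>\<^bsub>F2\<^esub> y \<otimes>\<^bsub>F2\<^esub> inv\<^bsub>F2\<^esub> g)"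

lemma letter_val_F2_closed [simp]: "x \<in> carrier F2 \<Longrightarrow> y \<in> carrier F2 \<Longrightarrow> letter_val F2 x y l \<in> carrier F2"
  by (rule letter_val_closed[OF group_F2])

lemma word_val_F2_closed [simp]: "x \<in> carrier F2 \<Longrightarrow> y \<in> carrier F2 \<Longrightarrow> word_val F2 x y w \<in> carrier F2"
  by (rule word_val_closed[OF group_F2])

lemma word_val_F2_simps:
  assumes "x \<in> carrier F2" "y \<in> carrier F2"
  shows "word_val F2 x y [] = []"
    "word_val F2 x y (l # w) = letter_val F2 x y l \<otimes>\<^bsub>F2\<^esub> word_val F2 x y w"
  using word_val_def[OF group_F2 assms] by (simp_all add: F2_simps)

text \<open>The parts of a factor that cancel at its two sides do not meet, so something of every
  factor survives in the product. The induction needs to know that the product starts with the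
  surviving part \<open>S\<close> of the first factor.\<close>
lemma small_cancellation_word_val:
  assumes xy: "x \<in> carrier F2" "y \<in> carrier F2"
    and small: "\<And>l l' l''. l' \<noteq> inv_letter l \<Longrightarrow> l'' \<noteq> inv_letter l' \<Longrightarrow>
      lost (letter_val F2 x y l) (letter_val F2 x y l') + lost (letter_val F2 x y l') (letter_val F2 x y l'')
      < 2 * length (letter_val F2 x y l')"
    and "reduced (l # l' # w)"
  shows "\<exists>S P C. word_val F2 x y (l # l' # w) = S @ P \<and> P \<noteq> [] \<and> letter_val F2 x y l = S @ C \<and>
    2 * length C = lost (letter_val F2 x y l) (letter_val F2 x y l')"
  using assms(4)
proof (induction w arbitrary: l l')
  case Nil
  let ?L = "letter_val F2 x y"
  obtain p w q where *: "?L l = p @ w" "?L l' = winv w @ q" "?L l \<otimes>\<^bsub>F2\<^esub> ?L l' = p @ q"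
    "lost (?L l) (?L l') = 2 * length w"
    using cancellation_lost[of "?L l" "?L l'"] xy by (metis letter_val_F2_closed)
  have "lost (?L l) (?L l') < 2 * length (?L l')" using small[of l' l l'] Nil by simp
  then have "q \<noteq> []" using *(2,4) by auto
  moreover have "word_val F2 x y [l, l'] = p @ q"
    using *(3) F2.r_one[OF letter_val_F2_closed[OF xy, of l']]
    by (simp add: word_val_F2_simps[OF xy] F2_simps(3))
  ultimately show ?case using * by metis
next
  case (Cons l'' w)
  let ?L = "letter_val F2 x y"
  obtain S P C where IH: "word_val F2 x y (l' # l'' # w) = S @ P" "P \<noteq> []" "?L l' = S @ C"
    "2 * length C = lost (?L l') (?L l'')"
    using Cons.IH[of l' l''] Cons.prems by auto
  obtain p d q where *: "?L l = p @ d" "?L l' = winv d @ q" "?L l \<otimes>\<^bsub>F2\<^esub> ?L l' = p @ q"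
    "lost (?L l) (?L l') = 2 * length d" "reduced (p @ q)"
    using cancellation_lost[of "?L l" "?L l'"] xy by (metis letter_val_F2_closed)
  have "lost (?L l) (?L l') + lost (?L l') (?L l'') < 2 * length (?L l')"
    using small[of l' l l''] Cons.prems by simp
  then have "length d < length S" using IH(3,4) *(4) by simp
  have "S @ C = winv d @ q" using IH(3) *(2) by simp
  then have "take (length d) S = winv d" "drop (length d) S @ C = q"
    using \<open>length d < length S\<close> by (auto simp: append_eq_append_conv_if split: if_splits)
  then obtain s where s: "S = winv d @ s" "q = s @ C"
    by (metis append_take_drop_id)
  have "s \<noteq> []" using s(1) \<open>length d < length S\<close> by auto
  have red: "reduced (winv d @ s @ P)" using word_val_F2_closed[OF xy, of "l' # l'' # w"] IH(1) s(1)
    by (simp add: F2_simps)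
  then have "reduced (s @ P)" by (simp add: reduced_append)
  moreover have "reduced (p @ s)" using *(5) s(2) reduced_append[of "p @ s" C] by simp
  ultimately have psP: "reduced (p @ s @ P)" using reduced_append3 \<open>s \<noteq> []\<close> by blast
  have "word_val F2 x y (l # l' # l'' # w) = foldr push (p @ d) (winv d @ s @ P)"
    using word_val_F2_simps(2)[OF xy, of l "l' # l'' # w"] IH(1) *(1) s(1) by (simp add: F2_simps)
  also have "winv d @ s @ P = foldr push (winv d) (s @ P)" using foldr_push_append[OF red] by simp
  also have "foldr push (p @ d) \<dots> = foldr push p (s @ P)"
    using foldr_push_inverse[OF \<open>reduced (s @ P)\<close>, of "winv d"] by (simp flip: winv_def)
  also have "\<dots> = p @ s @ P" using foldr_push_append[OF psP] by simp
  finally show ?case using *(1,4) IH(2) by (metis append_is_Nil_conv)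
qed

lemma generate_F2_word_val:
  assumes xy: "x \<in> carrier F2" "y \<in> carrier F2" and "g \<in> generate F2 {x, y}"
  obtains w where "reduced w" "g = word_val F2 x y w"
proof -
  interpret \<phi>: group_hom F2 F2 "word_val F2 x y"
    using word_val_hom[OF group_F2 xy] by unfold_locales
  have "word_val F2 x y gen_a = x" "word_val F2 x y gen_b = y"
    using xy by (simp_all add: gen_a_def gen_b_def word_val_F2_simps[OF xy] letter_val_def[OF group_F2 xy] F2.r_one[unfolded F2_simps(3)])
  then have "x \<in> word_val F2 x y ` carrier F2" "y \<in> word_val F2 x y ` carrier F2"
    by (metis gen_in_F2 imageI)+
  then have "generate F2 {x, y} \<subseteq> word_val F2 x y ` carrier F2"
    by (intro F2.generate_subgroup_incl \<phi>.img_is_subgroup) auto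
  then show thesis using assms(3) that by (auto simp: F2_simps)
qed

lemma gens_generate_F2: "generate F2 {gen_a, gen_b} = carrier F2"
proof
  show "generate F2 {gen_a, gen_b} \<subseteq> carrier F2" by (rule F2.generate_incl) simp
  show "carrier F2 \<subseteq> generate F2 {gen_a, gen_b}"
  proof
    fix w assume "w \<in> carrier F2"
    then have "reduced w" by (simp add: F2_simps)
    then show "w \<in> generate F2 {gen_a, gen_b}"
    proof (induction w)
      case Nil
      show ?case using generate.one[of F2] by (simp add: F2_simps)
    next
      case (Cons l w)
      obtain x s where l: "l = (x, s)" by fastforce
      have "[(x, True)] \<in> {gen_a, gen_b}" by (cases x) (simp_all add: gen_a_def gen_b_def)
      then have "[l] \<in> generate F2 {gen_a, gen_b}"
        using generate.incl[of _ _ F2] generate.inv[of _ _ F2] inv_gen_F2 l by (metis (full_types))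
      moreover have "[l] \<otimes>\<^bsub>F2\<^esub> w = l # w"
        using foldr_push_append[of "[l]" w] Cons.prems by (simp add: F2_simps)
      ultimately show ?case using Cons.IH[OF reduced_tl[OF Cons.prems]] generate.eng by metis
    qed
  qed
qed

definition generating_pair :: "f2_word \<Rightarrow> f2_word \<Rightarrow> bool" where
  "generating_pair x y \<longleftrightarrow> x \<in> carrier F2 \<and> y \<in> carrier F2 \<and> generate F2 {x, y} = carrier F2"

lemma generating_pairI:
  assumes "generating_pair x y" "x' \<in> carrier F2" "y' \<in> carrier F2" "x \<in> generate F2 {x', y'}" "y \<in> generate F2 {x', y'}"
  shows "generating_pair x' y'"
proof -
  have "generate F2 {x, y} \<subseteq> generate F2 {x', y'}" using assms by (intro F2.generate_mono_of_subset) auto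
  moreover have "generate F2 {x', y'} \<subseteq> carrier F2" using assms by (intro F2.generate_incl) auto
  ultimately show ?thesis using assms by (auto simp: generating_pair_def)
qed

lemma generating_pair_moves:
  assumes "generating_pair x y"
  shows "generating_pair y x" "generating_pair (inv\<^bsub>F2\<^esub> x) y" "generating_pair (x \<otimes>\<^bsub>F2\<^esub> y) y"
    "g \<in> carrier F2 \<Longrightarrow> generating_pair (g \<otimes>\<^bsub>F2\<^esub> x \<otimes>\<^bsub>F2\<^esub> inv\<^bsub>F2\<^esub> g) (g \<otimes>\<^bsub>F2\<^esub> y \<otimes>\<^bsub>F2\<^esub> inv\<^bsub>F2\<^esub> g)"
proof -
  have xy: "x \<in> carrier F2" "y \<in> carrier F2" using assms by (auto simp: generating_pair_def)
  show "generating_pair y x" using assms by (simp add: generating_pair_def insert_commute)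
  have incl: "s \<in> generate F2 {s, t}" "t \<in> generate F2 {s, t}" for s t
    by (auto intro: generate.incl)
  have x: "inv\<^bsub>F2\<^esub> (inv\<^bsub>F2\<^esub> x) \<in> generate F2 {inv\<^bsub>F2\<^esub> x, y}" by (rule generate.inv) simp
  then show "generating_pair (inv\<^bsub>F2\<^esub> x) y" using xy incl by (intro generating_pairI[OF assms]) auto
  have "(x \<otimes>\<^bsub>F2\<^esub> y) \<otimes>\<^bsub>F2\<^esub> inv\<^bsub>F2\<^esub> y \<in> generate F2 {x \<otimes>\<^bsub>F2\<^esub> y, y}"
    by (intro generate.eng generate.inv incl) simp
  then show "generating_pair (x \<otimes>\<^bsub>F2\<^esub> y) y" using xy incl by (intro generating_pairI[OF assms]) (auto simp: F2.m_assoc)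
  assume g: "g \<in> carrier F2"
  interpret c: group_hom F2 F2 "\<lambda>z. g \<otimes>\<^bsub>F2\<^esub> z \<otimes>\<^bsub>F2\<^esub> inv\<^bsub>F2\<^esub> g"
    by unfold_locales (use g in \<open>auto simp: hom_def F2.m_assoc F2.inv_solve_left\<close>)
  have "(\<lambda>z. g \<otimes>\<^bsub>F2\<^esub> z \<otimes>\<^bsub>F2\<^esub> inv\<^bsub>F2\<^esub> g) ` carrier F2 = carrier F2"
  proof (intro equalityI subsetI)
    fix z assume z: "z \<in> carrier F2"
    have "z = g \<otimes>\<^bsub>F2\<^esub> (inv\<^bsub>F2\<^esub> g \<otimes>\<^bsub>F2\<^esub> z \<otimes>\<^bsub>F2\<^esub> g) \<otimes>\<^bsub>F2\<^esub> inv\<^bsub>F2\<^esub> g"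
      using g z by (simp add: F2.m_assoc)
    then show "z \<in> (\<lambda>z. g \<otimes>\<^bsub>F2\<^esub> z \<otimes>\<^bsub>F2\<^esub> inv\<^bsub>F2\<^esub> g) ` carrier F2" using g z by blast
  qed (use g in auto)
  then show "generating_pair (g \<otimes>\<^bsub>F2\<^esub> x \<otimes>\<^bsub>F2\<^esub> inv\<^bsub>F2\<^esub> g) (g \<otimes>\<^bsub>F2\<^esub> y \<otimes>\<^bsub>F2\<^esub> inv\<^bsub>F2\<^esub> g)"
    using c.generate_img[of "{x, y}"] xy g assms by (simp add: generating_pair_def)
qed

text \<open>Otherwise the free group would be cyclic, but \<open>a\<close> and \<open>b\<close> do not commute.\<close>
lemma generating_pair_nonempty:
  assumes "generating_pair x y" shows "x \<noteq> []"
proof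
  assume "x = []"
  have xy: "x \<in> carrier F2" "y \<in> carrier F2" and gen: "generate F2 {x, y} = carrier F2"
    using assms by (auto simp: generating_pair_def)
  have x1: "x = \<one>\<^bsub>F2\<^esub>" using \<open>x = []\<close> by (simp add: F2_simps)
  have "s \<otimes>\<^bsub>F2\<^esub> y = y \<otimes>\<^bsub>F2\<^esub> s" if "s \<in> {x, y}" for s
    using that xy x1 by auto
  then have "gen_a \<otimes>\<^bsub>F2\<^esub> y = y \<otimes>\<^bsub>F2\<^esub> gen_a"
    using F2.generate_commute[of gen_a "{x, y}" y] xy gen by simp
  then have "s \<otimes>\<^bsub>F2\<^esub> gen_a = gen_a \<otimes>\<^bsub>F2\<^esub> s" if "s \<in> {x, y}" for s
    using that xy x1 by auto
  then have "gen_b \<otimes>\<^bsub>F2\<^esub> gen_a = gen_a \<otimes>\<^bsub>F2\<^esub> gen_b"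
    using F2.generate_commute[of gen_b "{x, y}" gen_a] xy gen by simp
  then show False by (simp add: F2_simps gen_a_def gen_b_def inv_letter_def)
qed

lemma carrier_F2_append:
  "u @ v \<in> carrier F2 \<Longrightarrow> u \<in> carrier F2 \<and> v \<in> carrier F2 \<and> u \<otimes>\<^bsub>F2\<^esub> v = u @ v"
  by (auto simp: F2_simps reduced_append foldr_push_append)

text \<open>Take a counterexample \<open>(x, y)\<close> of minimal total length. Then no product of a generator
  with the other one, up to inverses, is shorter than either factor, so at most half of a factor
  cancels at each side. If the two cancelled parts never exhaust a factor, then by
  \<open>small_cancellation_word_val\<close> a product of at least two letters in \<open>x, y\<close> has length at least
  two, so the letters \<open>a\<close> and \<open>b\<close> are themselves among \<open>x, y\<close> and their inverses. The remaining
  case is that exactly half of \<open>v = w\<inverse>q\<close> cancels at each side. There \<open>u = q\<inverse>mw\<close>, and replacing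
  \<open>(u, v)\<close> by the conjugate of \<open>(uv, v)\<close> with \<open>q\<close> gives the pair \<open>(m, qw\<inverse>)\<close>, which is shorter.
  (If instead of \<open>u\<close> its inverse stands on the right of \<open>v\<close>, then \<open>q = w\<close> and \<open>v\<close> would be
  trivial.)\<close>
theorem nielsen_rank_two:
  assumes "generating_pair x y"
  shows "nielsen x y"
proof (rule ccontr)
  assume "\<not> nielsen x y"
  define P where "P u v \<longleftrightarrow> generating_pair u v \<and> \<not> nielsen u v" for u v
  have carr: "u \<in> carrier F2" "v \<in> carrier F2" if "P u v" for u v
    using that by (auto simp: P_def generating_pair_def)
  have P_swap: "P v u" if "P u v" for u v
    using that by (auto simp: P_def intro: generating_pair_moves nielsen.swap)
  have P_inv: "P (inv\<^bsub>F2\<^esub> u) v" if "P u v" for u v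
    using that nielsen.inv[of "inv\<^bsub>F2\<^esub> u" v] carr[OF that] by (auto simp: P_def intro: generating_pair_moves)
  have P_mult: "P (u \<otimes>\<^bsub>F2\<^esub> v) v" if "P u v" for u v
  proof -
    have "nielsen u v" if "nielsen (u \<otimes>\<^bsub>F2\<^esub> v) v"
    proof -
      have "nielsen (u \<otimes>\<^bsub>F2\<^esub> v) (inv\<^bsub>F2\<^esub> v)" using that by (blast intro: nielsen.intros)
      then have "nielsen (u \<otimes>\<^bsub>F2\<^esub> v \<otimes>\<^bsub>F2\<^esub> inv\<^bsub>F2\<^esub> v) (inv\<^bsub>F2\<^esub> (inv\<^bsub>F2\<^esub> v))" by (blast intro: nielsen.intros)
      then show ?thesis using carr[OF \<open>P u v\<close>] by (simp add: F2.m_assoc)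
    qed
    then show ?thesis using that by (auto simp: P_def intro: generating_pair_moves)
  qed
  have P_conj: "P (g \<otimes>\<^bsub>F2\<^esub> u \<otimes>\<^bsub>F2\<^esub> inv\<^bsub>F2\<^esub> g) (g \<otimes>\<^bsub>F2\<^esub> v \<otimes>\<^bsub>F2\<^esub> inv\<^bsub>F2\<^esub> g)"
    if "P u v" "g \<in> carrier F2" for u v g
  proof -
    have *: "inv\<^bsub>F2\<^esub> g \<otimes>\<^bsub>F2\<^esub> (g \<otimes>\<^bsub>F2\<^esub> w \<otimes>\<^bsub>F2\<^esub> inv\<^bsub>F2\<^esub> g) \<otimes>\<^bsub>F2\<^esub> inv\<^bsub>F2\<^esub> (inv\<^bsub>F2\<^esub> g) = w" if "w \<in> carrier F2" for w
      using that \<open>g \<in> carrier F2\<close> by (simp add: F2.m_assoc)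
    show ?thesis using that nielsen.conj[of _ _ "inv\<^bsub>F2\<^esub> g"] *[OF carr(1)[OF that(1)]] *[OF carr(2)[OF that(1)]]
      by (metis F2.inv_closed P_def generating_pair_moves(4))
  qed

  define n where "n = (LEAST n. \<exists>u v. P u v \<and> length u + length v = n)"
  have "\<exists>n u v. P u v \<and> length u + length v = n" using assms \<open>\<not> nielsen x y\<close> P_def by blast
  then have "\<exists>u v. P u v \<and> length u + length v = n" unfolding n_def by (rule LeastI_ex)
  then obtain x y where xy: "P x y" "length x + length y = n" by blast
  have n_le: "n \<le> length u + length v" if "P u v" for u v
    unfolding n_def by (rule Least_le) (use that in blast)
  define D where "D u v \<longleftrightarrow> P u v \<and> length u + length v = n" for u v
  have D_swap: "D v u" and D_inv: "D (inv\<^bsub>F2\<^esub> u) v" if "D u v" for u v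
    using that P_swap P_inv carr length_inv_F2 by (auto simp: D_def)
  have left: "length u \<le> length (u \<otimes>\<^bsub>F2\<^esub> v)" if "D u v" for u v
    using n_le[OF P_mult] that by (fastforce simp: D_def)
  have right: "length v \<le> length (u \<otimes>\<^bsub>F2\<^esub> v)" if "D u v" for u v
  proof -
    have "D (inv\<^bsub>F2\<^esub> v) (inv\<^bsub>F2\<^esub> u)" using that D_swap D_inv by blast
    then have "length (inv\<^bsub>F2\<^esub> v) \<le> length (inv\<^bsub>F2\<^esub> v \<otimes>\<^bsub>F2\<^esub> inv\<^bsub>F2\<^esub> u)" by (rule left)
    also have "inv\<^bsub>F2\<^esub> v \<otimes>\<^bsub>F2\<^esub> inv\<^bsub>F2\<^esub> u = inv\<^bsub>F2\<^esub> (u \<otimes>\<^bsub>F2\<^esub> v)"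
      using carr[of u v] that by (simp add: D_def F2.inv_mult_group)
    finally show ?thesis using carr[of u v] that by (simp add: D_def length_inv_F2)
  qed
  have lost_le: "lost u v \<le> length u" "lost u v \<le> length v" if "D u v" for u v
    using left[OF that] right[OF that] unfolding lost_def by linarith+
  have nonempty: "u \<noteq> []" "v \<noteq> []" if "D u v" for u v
    using that D_swap[OF that] generating_pair_nonempty by (auto simp: D_def P_def)

  have no_half_same: False if D: "D u v" and half: "lost u v = length v" "lost v u = length v" for u v
  proof -
    have uv_in: "u \<in> carrier F2" "v \<in> carrier F2" using D carr by (auto simp: D_def)
    obtain p w q where 1: "u = p @ w" "v = winv w @ q" "u \<otimes>\<^bsub>F2\<^esub> v = p @ q" "length v = 2 * length w"
      using cancellation_lost[OF uv_in] half(1) by metis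
    obtain p' w' q' where 2: "v = p' @ w'" "u = winv w' @ q'" "length v = 2 * length w'"
      using cancellation_lost[OF uv_in(2,1)] half(2) by metis
    have "w' = q" using 1(2,4) 2(1,3) by simp
    have "length v \<le> length u" using lost_le(1)[OF D] half by simp
    then have "length (winv q) \<le> length p" using 1(1,2,4) by simp
    moreover have "winv q @ q' = p @ w" using 1(1) 2(2) \<open>w' = q\<close> by simp
    ultimately obtain m where m: "p = winv q @ m"
      by (metis append_eq_append_conv_if append_eq_conv_conj append_take_drop_id)
    have q: "q \<in> carrier F2" "winv w \<in> carrier F2" "v = winv w \<otimes>\<^bsub>F2\<^esub> q"
      using carrier_F2_append[of "winv w" q] uv_in(2) 1(2) by auto
    have "winv q @ m @ q \<in> carrier F2" using F2.m_closed[OF uv_in] 1(3) m by simp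
    then have m': "m \<in> carrier F2" "u \<otimes>\<^bsub>F2\<^esub> v = inv\<^bsub>F2\<^esub> q \<otimes>\<^bsub>F2\<^esub> (m \<otimes>\<^bsub>F2\<^esub> q)"
      using carrier_F2_append[of "winv q" "m @ q"] carrier_F2_append[of m q] 1(3) m inv_F2[OF q(1)] by auto
    have "P (q \<otimes>\<^bsub>F2\<^esub> (u \<otimes>\<^bsub>F2\<^esub> v) \<otimes>\<^bsub>F2\<^esub> inv\<^bsub>F2\<^esub> q) (q \<otimes>\<^bsub>F2\<^esub> v \<otimes>\<^bsub>F2\<^esub> inv\<^bsub>F2\<^esub> q)"
      using D P_mult P_conj q(1) by (auto simp: D_def)
    moreover have "q \<otimes>\<^bsub>F2\<^esub> (u \<otimes>\<^bsub>F2\<^esub> v) \<otimes>\<^bsub>F2\<^esub> inv\<^bsub>F2\<^esub> q = m"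
      using m' q(1) by (simp add: F2.m_assoc)
    moreover have "q \<otimes>\<^bsub>F2\<^esub> v \<otimes>\<^bsub>F2\<^esub> inv\<^bsub>F2\<^esub> q = q \<otimes>\<^bsub>F2\<^esub> winv w"
      using q by (simp add: F2.m_assoc)
    ultimately have "n \<le> length m + length (q \<otimes>\<^bsub>F2\<^esub> winv w)" using n_le by metis
    also have "\<dots> \<le> length m + (length q + length w)" using length_mult_F2[OF q(1,2)] by simp
    also have "\<dots> < length u + length v" using nonempty[OF D] 1(1,2,4) m by auto
    finally show False using D by (simp add: D_def)
  qed

  have no_half_inv: False if D: "D u v" and half: "lost u v = length v" "lost v (inv\<^bsub>F2\<^esub> u) = length v" for u v
  proof -
    have uv_in: "u \<in> carrier F2" "v \<in> carrier F2" using D carr by (auto simp: D_def)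
    obtain p w q where 1: "u = p @ w" "v = winv w @ q" "length v = 2 * length w"
      using cancellation_lost[OF uv_in] half(1) by metis
    obtain p' w' q' where 2: "v = p' @ w'" "inv\<^bsub>F2\<^esub> u = winv w' @ q'" "length v = 2 * length w'"
      using cancellation_lost[OF uv_in(2) F2.inv_closed[OF uv_in(1)]] half(2) by metis
    have "w' = q" "length q = length w" using 1(2,3) 2(1,3) by simp_all
    moreover have "winv w @ winv p = winv w' @ q'" using 2(2) 1(1) inv_F2[OF uv_in(1)] by simp
    ultimately have "winv w = winv q" by simp
    then have "q = w" using winv_simps(5) by metis
    then have "v = winv w \<otimes>\<^bsub>F2\<^esub> w" "w \<in> carrier F2" using carrier_F2_append[of "winv w" q] uv_in(2) 1(2) by auto
    then have "v = []" using inv_F2[of w] F2.l_inv[of w] by (simp add: F2_simps(3))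
    then show False using nonempty[OF D] by simp
  qed

  have xyc: "x \<in> carrier F2" "y \<in> carrier F2" using carr xy(1) by auto
  let ?L = "letter_val F2 x y"
  have L: "?L (Gen_a, True) = x" "?L (Gen_a, False) = inv\<^bsub>F2\<^esub> x" "?L (Gen_b, True) = y" "?L (Gen_b, False) = inv\<^bsub>F2\<^esub> y"
    by (simp_all add: letter_val_def[OF group_F2 xyc])
  have Dxy: "D x y" using xy by (simp add: D_def)
  have D_letters: "D (?L l) (?L l')" if "fst l \<noteq> fst l'" for l l'
  proof -
    note D_signs = Dxy D_inv[OF Dxy] D_swap[OF D_inv[OF D_swap[OF Dxy]]]
      D_inv[OF D_swap[OF D_inv[OF D_swap[OF Dxy]]]]
    obtain g s g' s' where l: "l = (g, s)" "l' = (g', s')" by fastforce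
    show ?thesis using that unfolding l
      by (cases g; cases g'; cases s; cases s') (simp_all only: L D_signs D_signs[THEN D_swap] fst_conv simp_thms f2_gen.distinct)
  qed
  have L_ne: "?L l \<noteq> []" for l
    using nonempty(1)[OF D_letters, of l "(if fst l = Gen_a then Gen_b else Gen_a, True)"] by (auto split: if_splits)
  have L_inv: "?L (inv_letter l) = inv\<^bsub>F2\<^esub> (?L l)" for l by (rule letter_val_inv[OF group_F2 xyc])
  have bounds: "lost (?L l) (?L l') \<le> length (?L l)" "lost (?L l) (?L l') \<le> length (?L l')"
    "fst l = fst l' \<Longrightarrow> lost (?L l) (?L l') < length (?L l')"
    "fst l = fst l' \<Longrightarrow> ?L l = ?L l'"
    if "l' \<noteq> inv_letter l" for l l'
  proof -
    have eq: "l = l'" if "fst l = fst l'"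
      using \<open>l' \<noteq> inv_letter l\<close> that by (cases l; cases l') (auto simp: inv_letter_def)
    then show "fst l = fst l' \<Longrightarrow> ?L l = ?L l'" by simp
    have strict: "lost (?L l) (?L l') < length (?L l')" if "fst l = fst l'"
      using lost_self[OF letter_val_F2_closed[OF xyc] L_ne, of l'] eq[OF that] by simp
    show "fst l = fst l' \<Longrightarrow> lost (?L l) (?L l') < length (?L l')" by (rule strict)
    have "lost (?L l) (?L l') \<le> length (?L l) \<and> lost (?L l) (?L l') \<le> length (?L l')"
    proof (cases "fst l = fst l'")
      case True
      then show ?thesis using strict[OF True] eq[OF True] by simp
    next
      case False
      then show ?thesis using lost_le[OF D_letters[OF False]] by simp
    qed
    then show "lost (?L l) (?L l') \<le> length (?L l)" "lost (?L l) (?L l') \<le> length (?L l')" by auto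
  qed
  have small: "lost (?L l) (?L l') + lost (?L l') (?L l'') < 2 * length (?L l')"
    if l: "l' \<noteq> inv_letter l" "l'' \<noteq> inv_letter l'" for l l' l''
  proof (rule ccontr)
    assume "\<not> ?thesis"
    then have half: "lost (?L l) (?L l') = length (?L l')" "lost (?L l') (?L l'') = length (?L l')"
      using bounds(2)[OF l(1)] bounds(1)[OF l(2)] by linarith+
    then have ne: "fst l \<noteq> fst l'" "fst l' \<noteq> fst l''"
      using bounds(3)[OF l(1)] bounds(3,4)[OF l(2)] by (metis less_irrefl)+
    then have "fst l'' = fst l" by (metis f2_gen.exhaust)
    then have "l'' = l \<or> l'' = inv_letter l" by (cases l; cases l'') (auto simp: inv_letter_def)
    then show False using no_half_same[OF D_letters[OF ne(1)]] no_half_inv[OF D_letters[OF ne(1)]] half L_inv by metis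
  qed
  have single: "\<exists>l. g = ?L l" if g: "length g = 1" "g \<in> carrier F2" for g
  proof -
    have "g \<in> generate F2 {x, y}" using g(2) xy(1) by (simp add: P_def generating_pair_def)
    then obtain w where w: "reduced w" "g = word_val F2 x y w" using generate_F2_word_val[OF xyc] by metis
    consider "w = []" | l where "w = [l]" | l l' w' where "w = l # l' # w'" by (metis list.exhaust)
    then show ?thesis
    proof cases
      case 1
      then show ?thesis using g(1) w(2) by (simp add: word_val_F2_simps[OF xyc])
    next
      case 2
      then have "g = ?L l" using w(2) F2.r_one[OF letter_val_F2_closed[OF xyc, of l]]
        by (simp add: word_val_F2_simps[OF xyc] F2_simps(3))
      then show ?thesis ..
    next
      case (3 l l' w')
      obtain S P C where SP: "g = S @ P" "P \<noteq> []" "?L l = S @ C" "2 * length C = lost (?L l) (?L l')"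
        using small_cancellation_word_val[OF xyc small] w 3 by metis
      have "lost (?L l) (?L l') < 2 * length (?L l)"
        using bounds(1)[of l' l] L_ne[of l] w(1) 3 by (cases "?L l") auto
      then have "S \<noteq> []" using SP(3,4) by auto
      then have "length g \<ge> 2" using SP(1,2) by (cases S; cases P) auto
      then show ?thesis using g(1) by simp
    qed
  qed
  obtain l l' where ab: "gen_a = ?L l" "gen_b = ?L l'" using single[of gen_a] single[of gen_b]
    by (auto simp: gen_a_def gen_b_def F2_simps)
  have ne: "fst l \<noteq> fst l'"
  proof
    assume "fst l = fst l'"
    then have "l' = l \<or> l' = inv_letter l" by (cases l; cases l') (auto simp: inv_letter_def)
    then have "gen_b = gen_a \<or> gen_b = inv\<^bsub>F2\<^esub> gen_a" using ab L_inv by metis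
    then show False by (auto simp: gen_a_def gen_b_def inv_gen_F2)
  qed
  have "D gen_a gen_b" using D_letters[OF ne] ab by simp
  then show False using nielsen.base by (simp add: D_def P_def)
qed

section \<open>The relations for the two matrix representations\<close>

interpretation GL: group "GL n" for n by (rule group_GL)

text \<open>A constant of its own, because the simplifier would expand the list into an iterated
  construction of vectors.\<close>
definition cvec :: "complex list \<Rightarrow> complex vec" where "cvec xs = vec_of_list xs"

lemma cvec_simps: "dim_vec (cvec xs) = length xs" "cvec xs $ i = xs ! i" "cvec xs = cvec ys \<longleftrightarrow> xs = ys"
  by (auto simp: cvec_def vec_of_list_index simp del: vec_of_list_Cons) (metis list_vec)

lemma cvec_carrier [simp]: "cvec xs \<in> carrier_vec n \<longleftrightarrow> length xs = n"
  unfolding carrier_vec_def mem_Collect_eq cvec_simps(1) by (rule refl)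

lemma vec_as_cvec: "v \<in> carrier_vec n \<Longrightarrow> v = cvec (map (($) v) [0..<n])"
  by (rule eq_vecI) (simp_all add: cvec_simps)

lemma GL_mat: "A \<in> carrier (GL n) \<Longrightarrow> A \<in> carrier_mat n n"
  by (auto simp: GL_def units_of_def Units_def ring_mat_def)

lemma GL_mult: "A \<otimes>\<^bsub>GL n\<^esub> B = A * B" and GL_one: "\<one>\<^bsub>GL n\<^esub> = 1\<^sub>m n"
  by (simp_all add: GL_def units_of_def ring_mat_def)

lemma GL_act:
  assumes "v \<in> carrier_vec n"
  shows "A \<in> carrier (GL n) \<Longrightarrow> B \<in> carrier (GL n) \<Longrightarrow> (A \<otimes>\<^bsub>GL n\<^esub> B) *\<^sub>v v = A *\<^sub>v (B *\<^sub>v v)"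
    "\<one>\<^bsub>GL n\<^esub> *\<^sub>v v = v" "A \<in> carrier (GL n) \<Longrightarrow> A *\<^sub>v v \<in> carrier_vec n"
  using assms by (auto simp: GL_mult GL_one dest!: GL_mat)

lemma GL_eqI:
  assumes "A \<in> carrier (GL n)" "B \<in> carrier (GL n)" "\<And>xs. length xs = n \<Longrightarrow> A *\<^sub>v cvec xs = B *\<^sub>v cvec xs"
  shows "A = B"
proof (rule mat_col_eqI)
  fix j assume j: "j < dim_col B"
  then have "unit_vec n j \<in> carrier_vec n" by simp
  then have "A *\<^sub>v unit_vec n j = B *\<^sub>v unit_vec n j"
    using vec_as_cvec[of "unit_vec n j" n] assms(3)[of "map (($) (unit_vec n j)) [0..<n]"] by simp
  moreover have "M *\<^sub>v unit_vec n j = col M j" if "M \<in> carrier_mat n n" for M :: "complex mat"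
    using that j GL_mat[OF assms(2)] by (auto intro!: eq_vecI)
  ultimately show "col A j = col B j" using GL_mat assms by metis
qed (use GL_mat[OF assms(1)] GL_mat[OF assms(2)] in auto)

lemma mat_of_rows_list_act:
  assumes "length xs = n" "\<And>r. r \<in> set rs \<Longrightarrow> length r = n"
  shows "mat_of_rows_list n rs *\<^sub>v cvec xs = cvec (map (\<lambda>r. \<Sum>(x, y)\<leftarrow>zip r xs. x * y) rs)"
proof (rule eq_vecI)
  fix i assume "i < dim_vec (cvec (map (\<lambda>r. \<Sum>(x, y)\<leftarrow>zip r xs. x * y) rs))"
  then have i: "i < length rs" by (simp add: cvec_simps)
  then have len: "length (rs ! i) = n" using assms(2) by simp
  have "(mat_of_rows_list n rs *\<^sub>v cvec xs) $ i = (\<Sum>j = 0..<n. rs ! i ! j * xs ! j)"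
    using i assms(1) by (simp add: mat_of_rows_list_def scalar_prod_def cvec_simps)
  also have "\<dots> = (\<Sum>(x, y)\<leftarrow>zip (rs ! i) xs. x * y)"
    using len assms(1) by (simp add: sum_list_sum_nth)
  finally show "(mat_of_rows_list n rs *\<^sub>v cvec xs) $ i = cvec (map (\<lambda>r. \<Sum>(x, y)\<leftarrow>zip r xs. x * y) rs) $ i"
    using i by (simp add: cvec_simps)
qed (simp add: cvec_simps mat_of_rows_list_def)

text \<open>Identities between words in the matrices are verified on a vector with symbolic entries,
  on which each letter acts by a short explicit formula.\<close>
lemma rho44_act:
  "rho44_a *\<^sub>v cvec [x0, x1, x2, x3, x4, x5, x6, x7, x8] =
    cvec [x0, - x1, - \<i> * x2, - \<i> * x3, - x4, x5, \<i> * x6, \<i> * x7, x8]"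
  "rho44_b *\<^sub>v cvec [x0, x1, x2, x3, x4, x5, x6, x7, x8] =
    cvec [x5 + x6, x7 - x4, x6 + x8, x7, - x1 - x2, x0 - x3, - x2, - x3 - x8, x8]"
proof -
  have "rho44_a = mat_of_rows_list 9 (map (\<lambda>i. map (\<lambda>j. if i = j then [1, -1, -\<i>, -\<i>, -1, 1, \<i>, \<i>, 1] ! i else 0) [0..<9]) [0..<9])"
    unfolding rho44_a_def mat_diag_def mat_of_rows_list_def by (rule eq_matI) auto
  also have "\<dots> *\<^sub>v cvec [x0, x1, x2, x3, x4, x5, x6, x7, x8] =
    cvec [x0, - x1, - \<i> * x2, - \<i> * x3, - x4, x5, \<i> * x6, \<i> * x7, x8]"
    by (subst mat_of_rows_list_act) (auto simp: cvec_simps upt_conv_Cons)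
  finally show "rho44_a *\<^sub>v cvec [x0, x1, x2, x3, x4, x5, x6, x7, x8] =
    cvec [x0, - x1, - \<i> * x2, - \<i> * x3, - x4, x5, \<i> * x6, \<i> * x7, x8]" .
  show "rho44_b *\<^sub>v cvec [x0, x1, x2, x3, x4, x5, x6, x7, x8] =
    cvec [x5 + x6, x7 - x4, x6 + x8, x7, - x1 - x2, x0 - x3, - x2, - x3 - x8, x8]"
    unfolding rho44_b_def by (subst mat_of_rows_list_act) (auto simp: cvec_simps)
qed

lemma rho4_act:
  "rho4_a *\<^sub>v cvec [x0, x1, x2, x3] = cvec [\<i> * x0, - \<i> * x1, x2, x3]"
  "rho4_b *\<^sub>v cvec [x0, x1, x2, x3] = cvec [x1 + x2, x3 - x0, x2, x3]"
  unfolding rho4_a_def rho4_b_def by (subst mat_of_rows_list_act; auto simp: cvec_simps)+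

lemma length_eq_9: "length xs = 9 \<Longrightarrow> \<exists>x0 x1 x2 x3 x4 x5 x6 x7 x8. xs = [x0, x1, x2, x3, x4, x5, x6, x7, x8]"
  by (auto simp: length_Suc_conv numeral_eq_Suc)

lemma length_eq_4: "length xs = 4 \<Longrightarrow> \<exists>x0 x1 x2 x3. xs = [x0, x1, x2, x3]"
  by (auto simp: length_Suc_conv numeral_eq_Suc)

lemmas rho_carrier [simp] = rho_in_GL

lemma GL_pow4: "A \<in> carrier (GL n) \<Longrightarrow> (\<And>xs. length xs = n \<Longrightarrow> A *\<^sub>v (A *\<^sub>v (A *\<^sub>v (A *\<^sub>v cvec xs))) = cvec xs) \<Longrightarrow>
   A [^]\<^bsub>GL n\<^esub> (4::nat) = \<one>\<^bsub>GL n\<^esub>"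
  by (rule GL_eqI[of _ n]) (auto simp: GL.pow4 GL_act)

lemma quartic_pair_rho44: "quartic_pair (GL 9) rho44_a rho44_b"
proof -
  have a: "rho44_a [^]\<^bsub>GL 9\<^esub> (4::nat) = \<one>\<^bsub>GL 9\<^esub>"
    by (rule GL_pow4) (auto dest!: length_eq_9 simp: rho44_act cvec_simps)
  have b: "rho44_b [^]\<^bsub>GL 9\<^esub> (4::nat) = \<one>\<^bsub>GL 9\<^esub>"
    by (rule GL_pow4) (auto dest!: length_eq_9 simp: rho44_act cvec_simps)
  show ?thesis
  proof unfold_locales
    show "(rho44_a \<otimes>\<^bsub>GL 9\<^esub> rho44_b) [^]\<^bsub>GL 9\<^esub> (4::nat) = \<one>\<^bsub>GL 9\<^esub>"
      by (rule GL_pow4) (auto dest!: length_eq_9 simp: GL_act rho44_act cvec_simps algebra_simps)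
    show "(rho44_a \<otimes>\<^bsub>GL 9\<^esub> inv\<^bsub>GL 9\<^esub> rho44_b) [^]\<^bsub>GL 9\<^esub> (4::nat) = \<one>\<^bsub>GL 9\<^esub>"
      unfolding GL.order_four_rules(2)[OF rho_carrier(2) b, symmetric]
      by (rule GL_pow4) (auto dest!: length_eq_9 simp: GL_act rho44_act cvec_simps algebra_simps)
    show "(rho44_a \<otimes>\<^bsub>GL 9\<^esub> (rho44_b \<otimes>\<^bsub>GL 9\<^esub> rho44_b)) [^]\<^bsub>GL 9\<^esub> (4::nat) = \<one>\<^bsub>GL 9\<^esub>"
      by (rule GL_pow4) (auto dest!: length_eq_9 simp: GL_act rho44_act cvec_simps algebra_simps)
    show "(rho44_a \<otimes>\<^bsub>GL 9\<^esub> rho44_a \<otimes>\<^bsub>GL 9\<^esub> rho44_b) [^]\<^bsub>GL 9\<^esub> (4::nat) = \<one>\<^bsub>GL 9\<^esub>"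
      by (rule GL_pow4) (auto dest!: length_eq_9 simp: GL_act rho44_act cvec_simps algebra_simps)
  qed (simp_all add: a b)
qed

lemma quartic_pair_rho4: "quartic_pair (GL 4) rho4_a rho4_b"
proof -
  have a: "rho4_a [^]\<^bsub>GL 4\<^esub> (4::nat) = \<one>\<^bsub>GL 4\<^esub>"
    by (rule GL_pow4) (auto dest!: length_eq_4 simp: rho4_act cvec_simps)
  have b: "rho4_b [^]\<^bsub>GL 4\<^esub> (4::nat) = \<one>\<^bsub>GL 4\<^esub>"
    by (rule GL_pow4) (auto dest!: length_eq_4 simp: rho4_act cvec_simps)
  show ?thesis
  proof unfold_locales
    show "(rho4_a \<otimes>\<^bsub>GL 4\<^esub> rho4_b) [^]\<^bsub>GL 4\<^esub> (4::nat) = \<one>\<^bsub>GL 4\<^esub>"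
      by (rule GL_pow4) (auto dest!: length_eq_4 simp: GL_act rho4_act cvec_simps algebra_simps)
    show "(rho4_a \<otimes>\<^bsub>GL 4\<^esub> inv\<^bsub>GL 4\<^esub> rho4_b) [^]\<^bsub>GL 4\<^esub> (4::nat) = \<one>\<^bsub>GL 4\<^esub>"
      unfolding GL.order_four_rules(2)[OF rho_carrier(4) b, symmetric]
      by (rule GL_pow4) (auto dest!: length_eq_4 simp: GL_act rho4_act cvec_simps algebra_simps)
    show "(rho4_a \<otimes>\<^bsub>GL 4\<^esub> (rho4_b \<otimes>\<^bsub>GL 4\<^esub> rho4_b)) [^]\<^bsub>GL 4\<^esub> (4::nat) = \<one>\<^bsub>GL 4\<^esub>"
      by (rule GL_pow4) (auto dest!: length_eq_4 simp: GL_act rho4_act cvec_simps algebra_simps)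
    show "(rho4_a \<otimes>\<^bsub>GL 4\<^esub> rho4_a \<otimes>\<^bsub>GL 4\<^esub> rho4_b) [^]\<^bsub>GL 4\<^esub> (4::nat) = \<one>\<^bsub>GL 4\<^esub>"
      by (rule GL_pow4) (auto dest!: length_eq_4 simp: GL_act rho4_act cvec_simps algebra_simps)
  qed (simp_all add: a b)
qed

section \<open>Exponents of a normal form as shear coefficients\<close>

lemma carrier_vecE:
  assumes "v \<in> carrier_vec n"
  obtains xs where "v = cvec xs" "length xs = n"
  using vec_as_cvec[OF assms] by (metis length_map length_upt diff_zero)

text \<open>Shears with the same \<open>F\<close> and \<open>k\<close> are closed under products, and the coefficients add up, so
  they give a homomorphism to an additive group that can be evaluated on a normal form. The
  coordinates outside \<open>F\<close> and \<open>k\<close> are left free, because the translations mix them.\<close>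
definition shear :: "nat \<Rightarrow> nat set \<Rightarrow> nat \<Rightarrow> (nat \<Rightarrow> complex) \<Rightarrow> complex mat \<Rightarrow> bool" where
  "shear n F k c M \<longleftrightarrow> M \<in> carrier (GL n) \<and> (\<forall>v\<in>carrier_vec n.
     (\<forall>f\<in>F. (M *\<^sub>v v) $ f = v $ f) \<and> (M *\<^sub>v v) $ k = v $ k + (\<Sum>f\<in>F. c f * v $ f))"

lemma shear_GL: "shear n F k c M \<Longrightarrow> M \<in> carrier (GL n)"
  by (simp add: shear_def)

lemma shear_one: "shear n F k (\<lambda>_. 0) \<one>\<^bsub>GL n\<^esub>"
  by (simp add: shear_def GL_act)

lemma shear_mult:
  assumes "shear n F k c M" "shear n F k d N"
  shows "shear n F k (\<lambda>f. c f + d f) (M \<otimes>\<^bsub>GL n\<^esub> N)"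
  using assms unfolding shear_def by (auto simp: GL_act algebra_simps sum.distrib)

lemma shear_inv:
  assumes "shear n F k c M"
  shows "shear n F k (\<lambda>f. - c f) (inv\<^bsub>GL n\<^esub> M)"
proof -
  have M: "M \<in> carrier (GL n)" using assms by (rule shear_GL)
  have "(\<forall>f\<in>F. (inv\<^bsub>GL n\<^esub> M *\<^sub>v v) $ f = v $ f) \<and> (inv\<^bsub>GL n\<^esub> M *\<^sub>v v) $ k = v $ k + (\<Sum>f\<in>F. - c f * v $ f)"
    if v: "v \<in> carrier_vec n" for v
  proof -
    define w where "w = inv\<^bsub>GL n\<^esub> M *\<^sub>v v"
    have w: "w \<in> carrier_vec n" using v M by (simp add: w_def GL_act)
    have "M *\<^sub>v w = v" using GL_act(1)[OF v M GL.inv_closed[OF M]] M v by (simp add: w_def GL_act)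
    then have 1: "\<forall>f\<in>F. v $ f = w $ f" and 2: "v $ k = w $ k + (\<Sum>f\<in>F. c f * w $ f)"
      using assms w unfolding shear_def by metis+
    have "(\<Sum>f\<in>F. c f * w $ f) = (\<Sum>f\<in>F. c f * v $ f)" using 1 by (intro sum.cong) auto
    then show ?thesis using 1 2 unfolding w_def[symmetric] by (simp add: sum_negf)
  qed
  then show ?thesis using M by (simp add: shear_def)
qed

lemma shear_int_pow:
  assumes "shear n F k c M"
  shows "shear n F k (\<lambda>f. of_int i * c f) (M [^]\<^bsub>GL n\<^esub> (i::int))"
proof -
  have M: "M \<in> carrier (GL n)" using assms by (rule shear_GL)
  have nat: "shear n F k (\<lambda>f. of_nat j * c f) (M [^]\<^bsub>GL n\<^esub> j)" for j :: nat
  proof (induction j)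
    case 0
    show ?case using shear_one by simp
  next
    case (Suc j)
    then show ?case using shear_mult[OF Suc assms] by (simp add: algebra_simps)
  qed
  show ?thesis
  proof (cases i rule: int_cases2)
    case (nonneg j)
    then show ?thesis using nat[of j] by (simp add: int_pow_int)
  next
    case (nonpos j)
    then show ?thesis using shear_inv[OF nat[of j]] M by (simp add: GL.int_pow_neg int_pow_int)
  qed
qed

lemma shear_trivial:
  assumes "shear n F k c \<one>\<^bsub>GL n\<^esub>" "finite F" "F \<subseteq> {..<n}" "f \<in> F"
  shows "c f = 0"
proof -
  have f: "f < n" using assms(3,4) by auto
  have "(\<Sum>g\<in>F. c g * unit_vec n f $ g) = 0"
    using assms(1) unfolding shear_def by (auto simp: GL_act dest!: bspec[of _ _ "unit_vec n f"])
  also have "(\<Sum>g\<in>F. c g * unit_vec n f $ g) = (\<Sum>g\<in>F. if g = f then c f else 0)"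
    using assms(3) f by (intro sum.cong) auto
  also have "\<dots> = c f" using assms(2,4) by simp
  finally show ?thesis by simp
qed

lemma shear_nf:
  assumes "quartic_pair (GL n) A B"
    and "shear n F k cp (quartic_pair.p (GL n) A B)" "shear n F k cq (quartic_pair.q (GL n) A B)"
      "shear n F k cu (quartic_pair.u (GL n) A B)" "shear n F k cv (quartic_pair.v (GL n) A B)"
      "shear n F k cz (quartic_pair.z (GL n) A B)"
  shows "shear n F k (\<lambda>f. of_int i * cp f + (of_int j * cq f + (of_int k' * cu f + (of_int l * cv f + of_int m * cz f))))
    (quartic_pair.nf (GL n) A B i j k' l m)"
  unfolding quartic_pair.nf_def[OF assms(1)] by (intro shear_mult shear_int_pow assms)

text \<open>The factor \<open>A\<^sup>s B\<^sup>t\<close> of a normal form that represents the identity is trivial. Test it on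
  a vector \<open>e\<close> that has coordinate \<open>k\<close> equal to 1 and whose image under \<open>B\<close> has coordinate \<open>k\<close>
  equal to 0; the coordinates in \<open>F\<close> vanish, so the shear \<open>M\<close> does not matter. Since \<open>A\<close>
  multiplies the coordinate \<open>k\<close> by a primitive fourth root of unity, \<open>t = 0\<close> and \<open>s\<close> is
  divisible by 4.\<close>
lemma shear_coset:
  assumes pair: "quartic_pair (GL n) A B" and M: "shear n F k c M"
    and eq: "M \<otimes>\<^bsub>GL n\<^esub> (A [^]\<^bsub>GL n\<^esub> (s::nat) \<otimes>\<^bsub>GL n\<^esub> B [^]\<^bsub>GL n\<^esub> (t::nat)) = \<one>\<^bsub>GL n\<^esub>" "t < 2"
    and A: "\<And>v. v \<in> carrier_vec n \<Longrightarrow> (A *\<^sub>v v) $ k = w * v $ k"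
      "\<And>v f. v \<in> carrier_vec n \<Longrightarrow> f \<in> F \<Longrightarrow> (A *\<^sub>v v) $ f = v $ f"
    and w: "w = \<i> \<or> w = - \<i>"
    and e: "e \<in> carrier_vec n" "e $ k = 1" "\<And>f. f \<in> F \<Longrightarrow> e $ f = 0" "(B *\<^sub>v e) $ k = 0" "\<And>f. f \<in> F \<Longrightarrow> (B *\<^sub>v e) $ f = 0"
  shows "t = 0" "4 dvd s" "M = \<one>\<^bsub>GL n\<^esub>"
proof -
  interpret quartic_pair "GL n" A B by (rule pair)
  have MG: "M \<in> carrier (GL n)" using M by (rule shear_GL)
  have As: "(A [^]\<^bsub>GL n\<^esub> s *\<^sub>v v) $ k = w ^ s * v $ k \<and> (\<forall>f\<in>F. (A [^]\<^bsub>GL n\<^esub> s *\<^sub>v v) $ f = v $ f)"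
    if "v \<in> carrier_vec n" for v and s :: nat
    using that
  proof (induction s arbitrary: v)
    case (Suc s)
    have "A *\<^sub>v v \<in> carrier_vec n" using Suc.prems by (simp add: GL_act)
    from Suc.IH[OF this] show ?case using A Suc.prems by (simp add: GL_act)
  qed (simp add: GL_act)
  define x where "x = B [^]\<^bsub>GL n\<^esub> t *\<^sub>v e"
  have x: "x \<in> carrier_vec n" using e(1) by (simp add: x_def GL_act)
  define y where "y = A [^]\<^bsub>GL n\<^esub> s *\<^sub>v x"
  have y: "y \<in> carrier_vec n" using x by (simp add: y_def GL_act)
  have t: "t = 0 \<or> t = 1" using eq(2) by linarith
  have xF: "\<forall>f\<in>F. x $ f = 0" using t e by (auto simp: x_def GL_act)
  then have yF: "\<forall>f\<in>F. y $ f = 0" using As[OF x] by (simp add: y_def)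
  have "M *\<^sub>v y = e" using arg_cong[OF eq(1), of "\<lambda>M. M *\<^sub>v e"] MG e(1)
    by (simp add: GL_act x_def y_def)
  then have "e $ k = y $ k + (\<Sum>f\<in>F. c f * y $ f)" using M y by (auto simp: shear_def)
  then have one: "w ^ s * x $ k = 1" using yF As[OF x] e(2) by (simp add: y_def)
  show "t = 0"
  proof (rule ccontr)
    assume "t \<noteq> 0"
    then have "x $ k = 0" using t e(1,4) by (simp add: x_def GL_act)
    then show False using one by simp
  qed
  then have "w ^ s = 1" using one e(1,2) by (simp add: x_def GL_act)
  have w4: "w ^ 4 = 1" "w \<noteq> 1" "w ^ 2 \<noteq> 1" "w ^ 3 \<noteq> 1" using w by (auto simp: power4_eq_xxxx power2_eq_square power3_eq_cube complex_eq_iff)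
  have "w ^ s = w ^ (4 * (s div 4) + s mod 4)" by simp
  also have "\<dots> = w ^ (s mod 4)" by (simp only: power_add power_mult w4(1) power_one mult_1)
  finally have "w ^ (s mod 4) = 1" using \<open>w ^ s = 1\<close> by simp
  moreover have "s mod 4 = 0 \<or> s mod 4 = 1 \<or> s mod 4 = 2 \<or> s mod 4 = 3" by linarith
  ultimately have "s mod 4 = 0" using w4 by auto
  then show dvd: "4 dvd s" by presburger
  then have "s = 4 * (s div 4)" by simp
  then have "A [^]\<^bsub>GL n\<^esub> s = (A [^]\<^bsub>GL n\<^esub> (4::nat)) [^]\<^bsub>GL n\<^esub> (s div 4)" by (metis GL.nat_pow_pow a_closed)
  then have "A [^]\<^bsub>GL n\<^esub> s = \<one>\<^bsub>GL n\<^esub>" by (simp add: quart)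
  then show "M = \<one>\<^bsub>GL n\<^esub>" using eq(1) \<open>t = 0\<close> MG by simp
qed

interpretation rho44: quartic_pair "GL 9" rho44_a rho44_b by (rule quartic_pair_rho44)
interpretation rho4: quartic_pair "GL 4" rho4_a rho4_b by (rule quartic_pair_rho4)

lemma rho44_inv_act:
  "inv\<^bsub>GL 9\<^esub> rho44_a *\<^sub>v cvec [x0, x1, x2, x3, x4, x5, x6, x7, x8] =
    cvec [x0, - x1, \<i> * x2, \<i> * x3, - x4, x5, - \<i> * x6, - \<i> * x7, x8]"
  "inv\<^bsub>GL 9\<^esub> rho44_b *\<^sub>v cvec [x0, x1, x2, x3, x4, x5, x6, x7, x8] =
    cvec [x5 - x7 - x8, x6 - x4, - x6, - x7 - x8, x3 - x1, x0 - x2 + x8, x2 - x8, x3, x8]"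
  unfolding rho44.a_rules(2)[symmetric] rho44.b_rules(2)[symmetric]
  by (simp_all add: GL_act rho44_act cvec_simps algebra_simps del: rho44.a_rules rho44.b_rules)

lemma rho4_inv_act:
  "inv\<^bsub>GL 4\<^esub> rho4_a *\<^sub>v cvec [x0, x1, x2, x3] = cvec [- \<i> * x0, \<i> * x1, x2, x3]"
  "inv\<^bsub>GL 4\<^esub> rho4_b *\<^sub>v cvec [x0, x1, x2, x3] = cvec [x3 - x1, x0 - x2, x2, x3]"
  unfolding rho4.a_rules(2)[symmetric] rho4.b_rules(2)[symmetric]
  by (simp_all add: GL_act rho4_act cvec_simps algebra_simps del: rho4.a_rules rho4.b_rules)

lemmas rho44_eval = rho44.element_defs GL_act rho44_act rho44_inv_act cvec_simps

lemma shearI: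
  assumes "M \<in> carrier (GL n)"
    "\<And>xs f. length xs = n \<Longrightarrow> f \<in> F \<Longrightarrow> (M *\<^sub>v cvec xs) $ f = xs ! f"
    "\<And>xs. length xs = n \<Longrightarrow> (M *\<^sub>v cvec xs) $ k = xs ! k + (\<Sum>f\<in>F. c f * xs ! f)"
  shows "shear n F k c M"
  unfolding shear_def
proof (intro conjI ballI assms(1))
  fix v :: "complex vec" and f assume "v \<in> carrier_vec n"
  then obtain xs where v: "v = cvec xs" "length xs = n" by (rule carrier_vecE)
  then show "(M *\<^sub>v v) $ k = v $ k + (\<Sum>f\<in>F. c f * v $ f)" using assms(3) by (simp add: cvec_simps)
  assume "f \<in> F" then show "(M *\<^sub>v v) $ f = v $ f" using v assms(2) by (simp add: cvec_simps)
qed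

lemma rho44_shear_2:
  "shear 9 {8} 2 (\<lambda>_. - 1) rho44.p" "shear 9 {8} 2 (\<lambda>_. \<i>) rho44.q"
  "shear 9 {8} 2 (\<lambda>_. \<i>) rho44.u" "shear 9 {8} 2 (\<lambda>_. - 1) rho44.v" "shear 9 {8} 2 (\<lambda>_. 0) rho44.z"
  by (rule shearI; (simp; fail)?; force dest!: length_eq_9 simp: rho44_eval algebra_simps)+

lemma rho44_shear_6:
  "shear 9 {8} 6 (\<lambda>_. 1) rho44.p" "shear 9 {8} 6 (\<lambda>_. \<i>) rho44.q"
  "shear 9 {8} 6 (\<lambda>_. 1) rho44.u" "shear 9 {8} 6 (\<lambda>_. - \<i>) rho44.v" "shear 9 {8} 6 (\<lambda>_. 0) rho44.z"
  by (rule shearI; (simp; fail)?; force dest!: length_eq_9 simp: rho44_eval algebra_simps)+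

text \<open>The coordinate 0 is moved by \<open>z\<close> in a shear, but \<open>p, q, u, v\<close> do not act on it as shears.
  It is used once their exponents are known to vanish.\<close>
lemma rho44_shear_0: "shear 9 {8} 0 (\<lambda>_. 2 * \<i>) rho44.z"
  by (rule shearI; (simp; fail)?; force dest!: length_eq_9 simp: rho44_eval algebra_simps)+

lemmas rho4_eval = rho4.element_defs GL_act rho4_act rho4_inv_act cvec_simps

lemma rho4_shear_0:
  "shear 4 {2, 3} 0 ((\<lambda>_. 0)(2 := - 1, 3 := - 1)) rho4.p" "shear 4 {2, 3} 0 ((\<lambda>_. 0)(2 := - \<i>, 3 := - \<i>)) rho4.q"
  "shear 4 {2, 3} 0 ((\<lambda>_. 0)(2 := - \<i>, 3 := - 1)) rho4.u" "shear 4 {2, 3} 0 ((\<lambda>_. 0)(2 := - 1, 3 := \<i>)) rho4.v"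
  "shear 4 {2, 3} 0 (\<lambda>_. 0) rho4.z"
  by (rule shearI; (simp; fail)?; force dest!: length_eq_4 simp: rho4_eval algebra_simps)+

lemma rho4_z: "rho4.z = \<one>\<^bsub>GL 4\<^esub>"
  by (rule GL_eqI[of _ 4]) (auto dest!: length_eq_4 simp: rho4_eval algebra_simps)

lemma rho44_nf_trivial:
  assumes "rho44.nf i j k l m \<otimes>\<^bsub>GL 9\<^esub> (rho44_a [^]\<^bsub>GL 9\<^esub> (s::nat) \<otimes>\<^bsub>GL 9\<^esub> rho44_b [^]\<^bsub>GL 9\<^esub> (t::nat)) = \<one>\<^bsub>GL 9\<^esub>" "t < 2"
  shows "i = 0" "j = 0" "k = 0" "l = 0" "m = 0" "t = 0" "4 dvd s"
proof -
  let ?M = "rho44.nf i j k l m"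
  let ?e = "cvec [0, 0, 1, 0, 0, 0, 0, 0, 0]"
  have act: "(rho44_a *\<^sub>v v) $ 2 = - \<i> * v $ 2 \<and> (rho44_a *\<^sub>v v) $ 8 = v $ 8" if "v \<in> carrier_vec 9" for v
  proof -
    from that obtain xs where "v = cvec xs" "length xs = 9" by (rule carrier_vecE)
    then show ?thesis by (auto dest!: length_eq_9 simp: rho44_act cvec_simps)
  qed
  note shear2 = shear_nf[OF quartic_pair_rho44 rho44_shear_2, of i j k l m]
  note shear6 = shear_nf[OF quartic_pair_rho44 rho44_shear_6, of i j k l m]
  have 1: "t = 0" "4 dvd s" "?M = \<one>\<^bsub>GL 9\<^esub>"
    by (rule shear_coset[OF quartic_pair_rho44 shear2 assms, of "- \<i>" ?e]; auto simp: act rho44_act cvec_simps)+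
  show "t = 0" "4 dvd s" by fact+
  have 2: "of_int i * - 1 + (of_int j * \<i> + (of_int k * \<i> + (of_int l * - 1 + of_int m * 0))) = (0::complex)"
    using shear_trivial[OF shear2[unfolded 1(3)], of 8] by simp
  have 3: "of_int i * 1 + (of_int j * \<i> + (of_int k * 1 + (of_int l * - \<i> + of_int m * 0))) = (0::complex)"
    using shear_trivial[OF shear6[unfolded 1(3)], of 8] by simp
  \<comment> \<open>real and imaginary parts of the two coefficients\<close>
  have "real_of_int (- i - l) = 0" "real_of_int (j + k) = 0" "real_of_int (i + k) = 0" "real_of_int (j - l) = 0"
    using arg_cong[OF 2, of Re] arg_cong[OF 2, of Im] arg_cong[OF 3, of Re] arg_cong[OF 3, of Im] by simp_all
  then have "- i - l = 0" "j + k = 0" "i + k = 0" "j - l = 0" by linarith+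
  then show ijkl: "i = 0" "j = 0" "k = 0" "l = 0" by linarith+
  have "?M = rho44.z [^]\<^bsub>GL 9\<^esub> m" using ijkl by (simp add: rho44.nf_def)
  then have "shear 9 {8} 0 (\<lambda>_. of_int m * (2 * \<i>)) \<one>\<^bsub>GL 9\<^esub>" using shear_int_pow[OF rho44_shear_0, of m] 1(3) by simp
  from shear_trivial[OF this, of 8] show "m = 0" by simp
qed

lemma rho4_nf_trivial:
  assumes "rho4.nf i j k l m \<otimes>\<^bsub>GL 4\<^esub> (rho4_a [^]\<^bsub>GL 4\<^esub> (s::nat) \<otimes>\<^bsub>GL 4\<^esub> rho4_b [^]\<^bsub>GL 4\<^esub> (t::nat)) = \<one>\<^bsub>GL 4\<^esub>" "t < 2"
  shows "i = 0" "j = 0" "k = 0" "l = 0" "t = 0" "4 dvd s"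
proof -
  let ?M = "rho4.nf i j k l m"
  let ?e = "cvec [1, 0, 0, 0]"
  have act: "(rho4_a *\<^sub>v v) $ 0 = \<i> * v $ 0 \<and> (rho4_a *\<^sub>v v) $ 2 = v $ 2 \<and> (rho4_a *\<^sub>v v) $ 3 = v $ 3" if "v \<in> carrier_vec 4" for v
  proof -
    from that obtain xs where "v = cvec xs" "length xs = 4" by (rule carrier_vecE)
    then show ?thesis by (auto dest!: length_eq_4 simp: rho4_act cvec_simps)
  qed
  note shear0 = shear_nf[OF quartic_pair_rho4 rho4_shear_0, of i j k l m]
  have 1: "t = 0" "4 dvd s" "?M = \<one>\<^bsub>GL 4\<^esub>"
    by (rule shear_coset[OF quartic_pair_rho4 shear0 assms, of "\<i>" ?e]; auto simp: act rho4_act cvec_simps)+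
  show "t = 0" "4 dvd s" by fact+
  have 2: "of_int i * - 1 + (of_int j * - \<i> + (of_int k * - \<i> + (of_int l * - 1 + of_int m * 0))) = (0::complex)"
    using shear_trivial[OF shear0[unfolded 1(3)], of 2] by simp
  have 3: "of_int i * - 1 + (of_int j * - \<i> + (of_int k * - 1 + (of_int l * \<i> + of_int m * 0))) = (0::complex)"
    using shear_trivial[OF shear0[unfolded 1(3)], of 3] by simp
  \<comment> \<open>real and imaginary parts of the two coefficients\<close>
  have "real_of_int (- i - l) = 0" "real_of_int (j + k) = 0" "real_of_int (i + k) = 0" "real_of_int (j - l) = 0"
    using arg_cong[OF 2, of Re] arg_cong[OF 2, of Im] arg_cong[OF 3, of Re] arg_cong[OF 3, of Im] by simp_all
  then have "- i - l = 0" "j + k = 0" "i + k = 0" "j - l = 0" by linarith+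
  then show "i = 0" "j = 0" "k = 0" "l = 0" by linarith+
qed

section \<open>The quotient by the fourth powers of primitive elements\<close>

context group_hom begin

lemma induced_coset:
  assumes "N \<lhd> G" "N \<subseteq> kernel G H h" "g \<in> carrier G"
  shows "induced h (N #>\<^bsub>G\<^esub> g) = h g"
proof -
  interpret N: normal N G by (rule assms(1))
  have "h ` (N #>\<^bsub>G\<^esub> g) = {h g}"
    using assms(2,3) N.one_closed by (force simp: r_coset_def kernel_def)
  then show ?thesis by (simp add: induced_def)
qed

lemma induced_hom:
  assumes "N \<lhd> G" "N \<subseteq> kernel G H h"
  shows "induced h \<in> hom (G Mod N) H"
proof -
  interpret N: normal N G by (rule assms(1))
  show ?thesis
  proof (rule homI)
    fix C D assume "C \<in> carrier (G Mod N)" "D \<in> carrier (G Mod N)"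
    then obtain g g' where C: "C = N #> g" "g \<in> carrier G" and D: "D = N #> g'" "g' \<in> carrier G"
      by (auto simp: FactGroup_def RCOSETS_def)
    show "induced h C \<in> carrier H" by (simp add: C induced_coset[OF assms])
    show "induced h (C \<otimes>\<^bsub>G Mod N\<^esub> D) = induced h C \<otimes>\<^bsub>H\<^esub> induced h D"
      using C D by (simp add: FactGroup_def N.rcos_sum induced_coset[OF assms])
  qed
qed

end

context quartic_pair begin

lemma hom_nf:
  assumes H: "group H" and h: "h \<in> hom G H"
  shows "h z = quartic_pair.z H (h a) (h b)"
    "h (nf i j k l m \<otimes> (a [^] (s::nat) \<otimes> b [^] (t::nat))) =
      quartic_pair.nf H (h a) (h b) i j k l m \<otimes>\<^bsub>H\<^esub> (h a [^]\<^bsub>H\<^esub> s \<otimes>\<^bsub>H\<^esub> h b [^]\<^bsub>H\<^esub> t)"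
proof -
  interpret h: group_hom G H h using H h by (simp add: group_hom_def group_hom_axioms_def is_group)
  interpret H: quartic_pair H "h a" "h b" by (rule quartic_pair_hom[OF H h])
  have hp: "h p = H.p" "h q = H.q" "h u = H.u" "h v = H.v"
    unfolding element_defs H.element_defs by (simp_all del: a_rules b_rules H.a_rules H.b_rules)
  show hz: "h z = H.z"
    unfolding element_defs H.element_defs by (simp del: a_rules b_rules H.a_rules H.b_rules)
  show "h (nf i j k l m \<otimes> (a [^] (s::nat) \<otimes> b [^] (t::nat))) =
      H.nf i j k l m \<otimes>\<^bsub>H\<^esub> (h a [^]\<^bsub>H\<^esub> s \<otimes>\<^bsub>H\<^esub> h b [^]\<^bsub>H\<^esub> t)"
    by (simp add: nf_def H.nf_def h.hom_int_pow h.hom_nat_pow hp hz)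
qed

end

lemma generating_pair_distinct:
  assumes "generating_pair x y" shows "x \<noteq> y"
proof
  assume "x = y"
  then have "generating_pair (inv\<^bsub>F2\<^esub> x \<otimes>\<^bsub>F2\<^esub> x) x" using assms generating_pair_moves(2,3) by metis
  moreover have "inv\<^bsub>F2\<^esub> x \<otimes>\<^bsub>F2\<^esub> x = []" using assms by (simp add: generating_pair_def F2_simps(3))
  ultimately show False using generating_pair_nonempty by metis
qed

lemma primitive_iff: "primitive x \<longleftrightarrow> (\<exists>y. generating_pair x y)"
proof
  assume "primitive x"
  then obtain S where S: "S \<subseteq> carrier F2" "card S = 2" "generate F2 S = carrier F2" "x \<in> S"
    by (auto simp: primitive_def)
  then obtain y where "S = {x, y}" by (metis card_2_iff insert_iff insert_commute singletonD)
  then show "\<exists>y. generating_pair x y" using S by (auto simp: generating_pair_def)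
next
  assume "\<exists>y. generating_pair x y"
  then obtain y where y: "generating_pair x y" by blast
  then have "card {x, y} = 2" using generating_pair_distinct by simp
  then show "primitive x" using y unfolding primitive_def generating_pair_def by (intro exI[of _ "{x, y}"]) simp
qed

text \<open>The moves on the pair \<open>(x, y)\<close> become the same moves on its image.\<close>
lemma quartic_pair_nielsen:
  assumes "group H" "\<rho> \<in> hom F2 H" "quartic_pair H (\<rho> gen_a) (\<rho> gen_b)" "nielsen x y"
  shows "x \<in> carrier F2 \<and> y \<in> carrier F2 \<and> quartic_pair H (\<rho> x) (\<rho> y)"
  using assms(4)
proof (induction rule: nielsen.induct)
  interpret \<rho>: group_hom F2 H \<rho> using assms(1,2) by (simp add: group_hom_def group_hom_axioms_def group_F2)
  {
    case base
    show ?case using assms(3) by simp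
  next
    case (swap x y)
    then show ?case using quartic_pair.quartic_pair_swap[of H "\<rho> x" "\<rho> y"] by simp
  next
    case (inv x y)
    then show ?case using quartic_pair.quartic_pair_inv[of H "\<rho> x" "\<rho> y"] by simp
  next
    case (mult x y)
    then show ?case using quartic_pair.quartic_pair_mult[of H "\<rho> x" "\<rho> y"] by simp
  next
    case (conj x y g)
    then show ?case using quartic_pair.quartic_pair_conj[of H "\<rho> x" "\<rho> y" "\<rho> g"] by simp
  }
qed

text \<open>By Nielsen's theorem a primitive element is the first member of a pair whose image
  satisfies the six relations, and the first of these says that its fourth power is killed.\<close>
lemma P4_subset_kernel:
  assumes "group H" "\<rho> \<in> hom F2 H" "quartic_pair H (\<rho> gen_a) (\<rho> gen_b)"
  shows "P4 \<subseteq> kernel F2 H \<rho>"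
proof -
  interpret \<rho>: group_hom F2 H \<rho> using assms(1,2) by (simp add: group_hom_def group_hom_axioms_def group_F2)
  have "x [^]\<^bsub>F2\<^esub> (4::nat) \<in> kernel F2 H \<rho>" if "primitive x" for x
  proof -
    obtain y where "nielsen x y" using \<open>primitive x\<close> nielsen_rank_two by (auto simp: primitive_iff)
    then have "x \<in> carrier F2" "quartic_pair H (\<rho> x) (\<rho> y)" using quartic_pair_nielsen[OF assms] by auto
    then show ?thesis using quartic_pair.quart(1) by (auto simp: kernel_def \<rho>.hom_nat_pow)
  qed
  then show ?thesis unfolding P4_def by (intro F2.generate_subgroup_incl \<rho>.subgroup_kernel) auto
qed

text \<open>It follows that the cosets of \<open>a\<close> and \<open>b\<close> satisfy the six relations in \<open>F\<^sub>2/P\<^sub>4\<close>.\<close>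
lemma primitive_words:
  "primitive gen_a" "primitive gen_b" "primitive (gen_a \<otimes>\<^bsub>F2\<^esub> gen_b)" "primitive (gen_a \<otimes>\<^bsub>F2\<^esub> inv\<^bsub>F2\<^esub> gen_b)"
  "primitive (gen_a \<otimes>\<^bsub>F2\<^esub> (gen_b \<otimes>\<^bsub>F2\<^esub> gen_b))" "primitive (gen_a \<otimes>\<^bsub>F2\<^esub> gen_a \<otimes>\<^bsub>F2\<^esub> gen_b)"
proof -
  have ab: "generating_pair gen_a gen_b" by (simp add: generating_pair_def gens_generate_F2)
  note ba = generating_pair_moves(1)[OF ab]
  have aB: "generating_pair gen_a (inv\<^bsub>F2\<^esub> gen_b)"
    by (rule generating_pair_moves(1)[OF generating_pair_moves(2)[OF ba]])
  have BA: "generating_pair (inv\<^bsub>F2\<^esub> gen_b) (inv\<^bsub>F2\<^esub> gen_a)"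
    by (rule generating_pair_moves(1)[OF generating_pair_moves(2)[OF aB]])
  have aab: "generating_pair (gen_a \<otimes>\<^bsub>F2\<^esub> gen_a \<otimes>\<^bsub>F2\<^esub> gen_b) (inv\<^bsub>F2\<^esub> gen_a)"
    using generating_pair_moves(2)[OF generating_pair_moves(3)[OF generating_pair_moves(3)[OF BA]]]
    by (simp add: F2.inv_mult_group F2.m_assoc)
  have abb: "generating_pair (gen_a \<otimes>\<^bsub>F2\<^esub> (gen_b \<otimes>\<^bsub>F2\<^esub> gen_b)) gen_b"
    using generating_pair_moves(3)[OF generating_pair_moves(3)[OF ab]] by (simp add: F2.m_assoc)
  have prim: "primitive x" if "generating_pair x y" for x y
    using that unfolding primitive_iff by (rule exI)
  show "primitive gen_a" "primitive gen_b" "primitive (gen_a \<otimes>\<^bsub>F2\<^esub> gen_b)" "primitive (gen_a \<otimes>\<^bsub>F2\<^esub> inv\<^bsub>F2\<^esub> gen_b)"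
    "primitive (gen_a \<otimes>\<^bsub>F2\<^esub> (gen_b \<otimes>\<^bsub>F2\<^esub> gen_b))" "primitive (gen_a \<otimes>\<^bsub>F2\<^esub> gen_a \<otimes>\<^bsub>F2\<^esub> gen_b)"
    by (rule prim[OF ab] prim[OF ba] prim[OF generating_pair_moves(3)[OF ab]] prim[OF generating_pair_moves(3)[OF aB]]
        prim[OF abb] prim[OF aab])+
qed

interpretation P4: normal P4 F2 by (rule P4_normal)

definition "\<Gamma> = F2 Mod P4"

lemma group_Gamma: "group \<Gamma>" unfolding \<Gamma>_def by (rule P4.factorgroup_is_group)

abbreviation coset :: "f2_word \<Rightarrow> f2_word set" where "coset w \<equiv> P4 #>\<^bsub>F2\<^esub> w"

lemma coset_hom: "coset \<in> hom F2 \<Gamma>" unfolding \<Gamma>_def by (rule P4.r_coset_hom_Mod)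

interpretation coset: group_hom F2 \<Gamma> coset
  using coset_hom group_Gamma by (simp add: group_hom_def group_hom_axioms_def group_F2)

lemma coset_eq_one_iff:
  assumes w: "w \<in> carrier F2"
  shows "coset w = \<one>\<^bsub>\<Gamma>\<^esub> \<longleftrightarrow> w \<in> P4"
  unfolding \<Gamma>_def one_FactGroup
  using F2.coset_join1[OF _ w P4.subgroup_axioms] F2.coset_join2[OF w P4.subgroup_axioms] by (rule iffI)

lemma carrier_Gamma: "carrier \<Gamma> = coset ` carrier F2"
  by (auto simp: \<Gamma>_def FactGroup_def RCOSETS_def)

lemma quartic_pair_Gamma: "quartic_pair \<Gamma> (coset gen_a) (coset gen_b)"
proof -
  have *: "coset x [^]\<^bsub>\<Gamma>\<^esub> (4::nat) = \<one>\<^bsub>\<Gamma>\<^esub>" if "primitive x" for x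
  proof -
    have x: "x \<in> carrier F2" using that by (auto simp: primitive_def)
    have "x [^]\<^bsub>F2\<^esub> (4::nat) \<in> P4" unfolding P4_def using that by (auto intro: generate.incl)
    then show ?thesis using x by (simp add: coset_eq_one_iff flip: coset.hom_nat_pow)
  qed
  show ?thesis
    using primitive_words[THEN *] by unfold_locales simp_all
qed

interpretation \<Gamma>: quartic_pair \<Gamma> "coset gen_a" "coset gen_b" by (rule quartic_pair_Gamma)

lemma Gamma_normal_form:
  assumes "g \<in> carrier \<Gamma>"
  obtains i j k l m s t where "t < 2"
    "g = \<Gamma>.nf i j k l m \<otimes>\<^bsub>\<Gamma>\<^esub> (coset gen_a [^]\<^bsub>\<Gamma>\<^esub> (s::nat) \<otimes>\<^bsub>\<Gamma>\<^esub> coset gen_b [^]\<^bsub>\<Gamma>\<^esub> (t::nat))"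
proof -
  have "generate \<Gamma> {coset gen_a, coset gen_b} = carrier \<Gamma>"
    using coset.generate_img[of "{gen_a, gen_b}"] by (simp add: gens_generate_F2 carrier_Gamma)
  then have "\<Gamma>.normal_form g" using assms \<Gamma>.generate_normal_form by simp
  then show thesis using that by (auto simp: \<Gamma>.normal_form_def)
qed

lemma Gamma_a_pow: "4 dvd s \<Longrightarrow> coset gen_a [^]\<^bsub>\<Gamma>\<^esub> (s::nat) = \<one>\<^bsub>\<Gamma>\<^esub>"
  using monoid.nat_pow_pow[OF group.is_monoid[OF group_Gamma] \<Gamma>.a_closed, of 4]
  by (auto simp: \<Gamma>.quart(1))

context
  fixes \<rho> :: "f2_word \<Rightarrow> complex mat"
  assumes \<rho>: "\<rho> \<in> hom F2 (GL 9)" "\<rho> gen_a = rho44_a" "\<rho> gen_b = rho44_b"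
begin

lemma P4_subset_kernel_rho44: "P4 \<subseteq> kernel F2 (GL 9) \<rho>"
  using P4_subset_kernel[OF group_GL \<rho>(1)] \<rho>(2,3) quartic_pair_rho44 by simp

interpretation \<rho>: group_hom F2 "GL 9" \<rho>
  using \<rho>(1) by (simp add: group_hom_def group_hom_axioms_def group_F2 group_GL)

lemma induced_rho44: "induced \<rho> \<in> hom \<Gamma> (GL 9)" "w \<in> carrier F2 \<Longrightarrow> induced \<rho> (coset w) = \<rho> w"
  using \<rho>.induced_hom \<rho>.induced_coset P4_normal P4_subset_kernel_rho44 by (auto simp: \<Gamma>_def)

text \<open>Faithfulness: a coset in the kernel has a normal form, whose image is the normal form with
  the same exponents for the matrices, and there all exponents are determined.\<close>
lemma induced_rho44_mon: "induced \<rho> \<in> mon \<Gamma> (GL 9)"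
proof -
  have "g = \<one>\<^bsub>\<Gamma>\<^esub>" if g: "g \<in> carrier \<Gamma>" "induced \<rho> g = \<one>\<^bsub>GL 9\<^esub>" for g
  proof -
    obtain i j k l m s t where t: "t < 2" and
      eq: "g = \<Gamma>.nf i j k l m \<otimes>\<^bsub>\<Gamma>\<^esub> (coset gen_a [^]\<^bsub>\<Gamma>\<^esub> (s::nat) \<otimes>\<^bsub>\<Gamma>\<^esub> coset gen_b [^]\<^bsub>\<Gamma>\<^esub> (t::nat))"
      using g(1) by (rule Gamma_normal_form)
    have "rho44.nf i j k l m \<otimes>\<^bsub>GL 9\<^esub> (rho44_a [^]\<^bsub>GL 9\<^esub> s \<otimes>\<^bsub>GL 9\<^esub> rho44_b [^]\<^bsub>GL 9\<^esub> t) = \<one>\<^bsub>GL 9\<^esub>"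
      using g(2) \<Gamma>.hom_nf(2)[OF group_GL induced_rho44(1), of i j k l m s t] \<rho>(2,3)
      by (simp add: eq induced_rho44(2))
    from rho44_nf_trivial[OF this t] show ?thesis
      by (simp add: eq Gamma_a_pow \<Gamma>.nf_def)
  qed
  then show ?thesis using mon_iff_hom_one[OF group_Gamma group_GL] induced_rho44(1) by blast
qed

lemma kernel_rho44: "kernel F2 (GL 9) \<rho> = P4"
proof
  show "kernel F2 (GL 9) \<rho> \<subseteq> P4"
  proof
    fix w assume w: "w \<in> kernel F2 (GL 9) \<rho>"
    then have "coset w = \<one>\<^bsub>\<Gamma>\<^esub>"
      using induced_rho44_mon mon_iff_hom_one[OF group_Gamma group_GL] induced_rho44(2)[of w]
      by (auto simp: kernel_def)
    then show "w \<in> P4" using w coset_eq_one_iff by (simp add: kernel_def)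
  qed
qed (rule P4_subset_kernel_rho44)

lemma z_infinite_order:
  assumes "\<Gamma>.z [^]\<^bsub>\<Gamma>\<^esub> (m::int) = \<one>\<^bsub>\<Gamma>\<^esub>"
  shows "m = 0"
proof -
  interpret h: group_hom \<Gamma> "GL 9" "induced \<rho>"
    using induced_rho44(1) by (simp add: group_hom_def group_hom_axioms_def group_Gamma group_GL)
  have "rho44.z [^]\<^bsub>GL 9\<^esub> m = \<one>\<^bsub>GL 9\<^esub>"
    using h.hom_int_pow[of \<Gamma>.z m] \<Gamma>.hom_nf(1)[OF group_GL induced_rho44(1)] assms \<rho>(2,3) h.hom_one
    by (simp add: induced_rho44(2))
  then have "rho44.nf 0 0 0 0 m \<otimes>\<^bsub>GL 9\<^esub> (rho44_a [^]\<^bsub>GL 9\<^esub> (0::nat) \<otimes>\<^bsub>GL 9\<^esub> rho44_b [^]\<^bsub>GL 9\<^esub> (0::nat)) = \<one>\<^bsub>GL 9\<^esub>"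
    by (simp add: rho44.nf_def)
  from rho44_nf_trivial(5)[OF this] show ?thesis by simp
qed

end

text \<open>The matrices determine the exponents of \<open>p, q, u, v\<close>, but the image of \<open>z\<close> is the
  identity.\<close>
lemma kernel_rho4_iff:
  assumes \<rho>: "\<rho> \<in> hom F2 (GL 4)" "\<rho> gen_a = rho4_a" "\<rho> gen_b = rho4_b" and w: "w \<in> carrier F2"
  shows "\<rho> w = \<one>\<^bsub>GL 4\<^esub> \<longleftrightarrow> (\<exists>m::int. coset w = \<Gamma>.z [^]\<^bsub>\<Gamma>\<^esub> m)"
proof -
  interpret \<rho>: group_hom F2 "GL 4" \<rho>
    using \<rho>(1) by (simp add: group_hom_def group_hom_axioms_def group_F2 group_GL)
  have P4: "P4 \<subseteq> kernel F2 (GL 4) \<rho>"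
    using P4_subset_kernel[OF group_GL \<rho>(1)] \<rho>(2,3) quartic_pair_rho4 by simp
  have hom: "induced \<rho> \<in> hom \<Gamma> (GL 4)"
    using \<rho>.induced_hom[OF P4_normal P4] by (simp add: \<Gamma>_def)
  note ind = \<rho>.induced_coset[OF P4_normal P4]
  interpret h: group_hom \<Gamma> "GL 4" "induced \<rho>"
    using hom by (simp add: group_hom_def group_hom_axioms_def group_Gamma group_GL)
  show ?thesis
  proof
    assume 1: "\<rho> w = \<one>\<^bsub>GL 4\<^esub>"
    have "coset w \<in> carrier \<Gamma>" using w by simp
    then obtain i j k l m s t where t: "t < 2" and
      eq: "coset w = \<Gamma>.nf i j k l m \<otimes>\<^bsub>\<Gamma>\<^esub> (coset gen_a [^]\<^bsub>\<Gamma>\<^esub> (s::nat) \<otimes>\<^bsub>\<Gamma>\<^esub> coset gen_b [^]\<^bsub>\<Gamma>\<^esub> (t::nat))"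
      by (rule Gamma_normal_form)
    have "rho4.nf i j k l m \<otimes>\<^bsub>GL 4\<^esub> (rho4_a [^]\<^bsub>GL 4\<^esub> s \<otimes>\<^bsub>GL 4\<^esub> rho4_b [^]\<^bsub>GL 4\<^esub> t) = \<one>\<^bsub>GL 4\<^esub>"
      using 1 \<Gamma>.hom_nf(2)[OF group_GL hom, of i j k l m s t] \<rho>(2,3) ind[OF w]
      by (simp add: ind flip: eq)
    from rho4_nf_trivial[OF this t] have "coset w = \<Gamma>.z [^]\<^bsub>\<Gamma>\<^esub> m"
      by (simp add: eq Gamma_a_pow \<Gamma>.nf_def)
    then show "\<exists>m::int. coset w = \<Gamma>.z [^]\<^bsub>\<Gamma>\<^esub> m" ..
  next
    assume "\<exists>m::int. coset w = \<Gamma>.z [^]\<^bsub>\<Gamma>\<^esub> m"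
    then obtain m :: int where "coset w = \<Gamma>.z [^]\<^bsub>\<Gamma>\<^esub> m" ..
    moreover have "induced \<rho> \<Gamma>.z = \<one>\<^bsub>GL 4\<^esub>"
      using \<Gamma>.hom_nf(1)[OF group_GL hom] rho4_z \<rho>(2,3) by (simp add: ind)
    ultimately have "induced \<rho> (coset w) = \<one>\<^bsub>GL 4\<^esub>"
      using h.hom_int_pow[of \<Gamma>.z m] GL.int_pow_one by simp
    then show "\<rho> w = \<one>\<^bsub>GL 4\<^esub>" by (simp add: ind w)
  qed
qed

lemma Z_pow_simps:
  "carrier (Z_pow d) = (\<Pi>\<^sub>E i\<in>{..<d}. UNIV)"
  "f \<otimes>\<^bsub>Z_pow d\<^esub> g = (\<lambda>i\<in>{..<d}. f i + g i)" "group (Z_pow d)"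
  by (simp_all add: Z_pow_def)

text \<open>If \<open>\<int>\<^sup>d\<close> is infinite cyclic, then \<open>d \<noteq> 0\<close>, and for \<open>d \<ge> 2\<close> the images \<open>x\<^sup>m\<close> and \<open>x\<^sup>n\<close> of
  the first two basis vectors would satisfy a relation: \<open>n\<close> times the first and \<open>m\<close> times the
  second have the same image.\<close>
lemma Z_pow_rank_one:
  assumes G: "group G" and x: "x \<in> carrier G" and inf: "\<And>m::int. x [^]\<^bsub>G\<^esub> m = \<one>\<^bsub>G\<^esub> \<Longrightarrow> m = 0"
  shows "(\<exists>\<iota>\<in>mon (Z_pow d) G. \<iota> ` carrier (Z_pow d) = range (\<lambda>m::int. x [^]\<^bsub>G\<^esub> m)) \<longleftrightarrow> d = 1"
proof -
  interpret G: group G by (rule G)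
  have inj: "m = n" if "x [^]\<^bsub>G\<^esub> (m::int) = x [^]\<^bsub>G\<^esub> n" for m n
  proof -
    have "x [^]\<^bsub>G\<^esub> (m - n) = \<one>\<^bsub>G\<^esub>" using that x by (simp add: G.int_pow_diff)
    then show ?thesis using inf by fastforce
  qed
  show ?thesis
  proof
    assume d: "d = 1"
    define \<iota> where "\<iota> f = x [^]\<^bsub>G\<^esub> (f 0 :: int)" for f :: "nat \<Rightarrow> int"
    have "\<iota> \<in> mon (Z_pow d) G"
      unfolding mon_def mem_Collect_eq
    proof
      show "\<iota> \<in> hom (Z_pow d) G"
        using d x by (auto simp: hom_def \<iota>_def Z_pow_simps G.int_pow_mult)
      show "inj_on \<iota> (carrier (Z_pow d))"
      proof (rule inj_onI)
        fix f g assume fg: "f \<in> carrier (Z_pow d)" "g \<in> carrier (Z_pow d)" "\<iota> f = \<iota> g"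
        then have "f 0 = g 0" using inj by (simp add: \<iota>_def)
        then show "f = g" using fg(1,2) d unfolding Z_pow_simps by (intro PiE_ext[of f _ _ g]) auto
      qed
    qed
    moreover have "\<iota> ` carrier (Z_pow d) = range (\<lambda>m::int. x [^]\<^bsub>G\<^esub> m)"
    proof (intro equalityI subsetI)
      fix y assume "y \<in> range (\<lambda>m::int. x [^]\<^bsub>G\<^esub> m)"
      then obtain m :: int where "y = \<iota> (\<lambda>i\<in>{..<d}. m)" using d by (auto simp: \<iota>_def)
      then show "y \<in> \<iota> ` carrier (Z_pow d)" by (auto simp: Z_pow_simps)
    qed (auto simp: \<iota>_def)
    ultimately show "\<exists>\<iota>\<in>mon (Z_pow d) G. \<iota> ` carrier (Z_pow d) = range (\<lambda>m::int. x [^]\<^bsub>G\<^esub> m)" by blast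
  next
    assume "\<exists>\<iota>\<in>mon (Z_pow d) G. \<iota> ` carrier (Z_pow d) = range (\<lambda>m::int. x [^]\<^bsub>G\<^esub> m)"
    then obtain \<iota> where \<iota>: "\<iota> \<in> hom (Z_pow d) G" "inj_on \<iota> (carrier (Z_pow d))"
      and img: "\<iota> ` carrier (Z_pow d) = range (\<lambda>m::int. x [^]\<^bsub>G\<^esub> m)" by (auto simp: mon_def)
    \<comment> \<open>\<open>n\<close> times the basis vector number \<open>i\<close>\<close>
    define e where "e i n = (\<lambda>j\<in>{..<d}. if j = i then n else 0)" for i :: nat and n :: int
    have e: "e i n \<in> carrier (Z_pow d)" for i n by (simp add: e_def Z_pow_simps)
    have pow: "\<iota> (e i n) = \<iota> (e i 1) [^]\<^bsub>G\<^esub> n" for i n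
    proof -
      have "(\<lambda>n. \<iota> (e i n)) \<in> hom integer_group G"
      proof (rule homI)
        fix m n :: int
        have "e i (m + n) = e i m \<otimes>\<^bsub>Z_pow d\<^esub> e i n" by (auto simp: e_def Z_pow_simps)
        then show "\<iota> (e i (m \<otimes>\<^bsub>integer_group\<^esub> n)) = \<iota> (e i m) \<otimes>\<^bsub>G\<^esub> \<iota> (e i n)"
          using \<iota>(1) e by (simp add: hom_mult)
      qed (use \<iota>(1) e in \<open>auto simp: hom_def\<close>)
      then interpret \<phi>: group_hom integer_group G "\<lambda>n. \<iota> (e i n)"
        by (simp add: group_hom_def group_hom_axioms_def G)
      show ?thesis using \<phi>.hom_int_pow[of 1 n] by simp
    qed
    have "d \<noteq> 0"
    proof
      assume "d = 0"
      then have "\<iota> ` carrier (Z_pow d) = {\<iota> (\<lambda>_. undefined)}" by (simp add: Z_pow_simps)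
      then have "x [^]\<^bsub>G\<^esub> (0::int) = x [^]\<^bsub>G\<^esub> (1::int)" using img by (metis rangeI singletonD)
      then show False using inj by fastforce
    qed
    moreover have "\<not> 2 \<le> d"
    proof
      assume d: "2 \<le> d"
      obtain m n :: int where m: "\<iota> (e 0 1) = x [^]\<^bsub>G\<^esub> m" and n: "\<iota> (e 1 1) = x [^]\<^bsub>G\<^esub> n"
        using img e by (metis (no_types, lifting) image_eqI rangeE)
      have "\<iota> (e 0 n) = x [^]\<^bsub>G\<^esub> (m * n)" using pow[of 0 n] m x by (simp add: G.int_pow_pow)
      moreover have "\<iota> (e 1 m) = x [^]\<^bsub>G\<^esub> (m * n)" using pow[of 1 m] n x by (simp add: G.int_pow_pow mult.commute)
      ultimately have "e 0 n = e 1 m" using inj_onD[OF \<iota>(2)] e by metis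
      then have "e 0 n 0 = e 1 m 0" by simp
      then have "n = 0" using d by (simp add: e_def)
      then have "\<iota> (e 1 1) = \<iota> (e 1 0)" using n pow[of 1 0] by simp
      then have "e 1 1 = e 1 0" using inj_onD[OF \<iota>(2)] e by metis
      then have "e 1 1 1 = e 1 0 1" by simp
      then show False using d by (simp add: e_def)
    qed
    ultimately show "d = 1" by linarith
  qed
qed

theorem theorem4p2:
  fixes \<rho>44 \<rho>4 :: "f2_word \<Rightarrow> complex mat"
  assumes "\<rho>44 \<in> hom F2 (GL 9)" and "\<rho>44 gen_a = rho44_a" and "\<rho>44 gen_b = rho44_b"
    and "\<rho>4 \<in> hom F2 (GL 4)" and "\<rho>4 gen_a = rho4_a" and "\<rho>4 gen_b = rho4_b"
  shows "P4 \<subseteq> kernel F2 (GL 9) \<rho>44 \<and>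
    induced \<rho>44 \<in> mon (F2 Mod P4) (GL 9) \<and>
    kernel F2 (GL 9) \<rho>44 \<subseteq> kernel F2 (GL 4) \<rho>4 \<and>
    (let Q44 = F2 Mod kernel F2 (GL 9) \<rho>44;
         Q4 = F2 Mod kernel F2 (GL 4) \<rho>4;
         \<pi> = quot_map (kernel F2 (GL 4) \<rho>4)
     in induced \<rho>44 \<in> iso (Q44\<lparr>carrier := kernel Q44 Q4 \<pi>\<rparr>)
                          ((GL 9)\<lparr>carrier := \<rho>44 ` kernel F2 (GL 4) \<rho>4\<rparr>) \<and>
        (\<forall>d. (\<exists>\<iota>. short_exact (Z_pow d) Q44 Q4 \<iota> \<pi>) \<longleftrightarrow> d = 1))"
proof -
  define K where "K = kernel F2 (GL 4) \<rho>4"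
  define Q where "Q = F2 Mod K"
  define \<pi> where "\<pi> = quot_map K"
  have K_iff: "w \<in> K \<longleftrightarrow> w \<in> carrier F2 \<and> \<rho>4 w = \<one>\<^bsub>GL 4\<^esub>" for w
    by (simp add: K_def kernel_def)
  note ker44 = kernel_rho44[OF assms(1-3)]
  note ind44 = induced_rho44(2)[OF assms(1-3)]
  have mon: "induced \<rho>44 \<in> mon \<Gamma> (GL 9)" by (rule induced_rho44_mon[OF assms(1-3)])
  interpret \<rho>4: group_hom F2 "GL 4" \<rho>4
    using assms(4) by (simp add: group_hom_def group_hom_axioms_def group_F2 group_GL)
  have P4_K: "P4 \<subseteq> K"
    unfolding K_def using P4_subset_kernel[OF group_GL assms(4)] assms(5,6) quartic_pair_rho4 by simp
  have K: "K \<lhd> F2" unfolding K_def by (rule \<rho>4.normal_kernel)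
  interpret K: normal K F2 by (rule K)
  have group_Q: "group Q" unfolding Q_def by (rule K.factorgroup_is_group)
  interpret q: group_hom F2 Q "\<lambda>g. K #>\<^bsub>F2\<^esub> g"
    using K.r_coset_hom_Mod group_Q by (simp add: group_hom_def group_hom_axioms_def group_F2 Q_def)
  have q_one: "K #>\<^bsub>F2\<^esub> w = \<one>\<^bsub>Q\<^esub> \<longleftrightarrow> w \<in> K" if "w \<in> carrier F2" for w
    unfolding Q_def one_FactGroup
    using F2.coset_join1[OF _ that K.subgroup_axioms] F2.coset_join2[OF that K.subgroup_axioms] by (rule iffI)
  have "P4 \<subseteq> kernel F2 Q (\<lambda>g. K #>\<^bsub>F2\<^esub> g)"
    using P4_K q_one P4.subset unfolding kernel_def by blast
  note \<pi>_facts = q.induced_hom[OF P4_normal this] q.induced_coset[OF P4_normal this]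
  have \<pi>_hom: "\<pi> \<in> hom \<Gamma> Q" and \<pi>_coset: "\<pi> (coset w) = K #>\<^bsub>F2\<^esub> w" if "w \<in> carrier F2" for w
    using \<pi>_facts that by (simp_all add: \<pi>_def quot_map_def \<Gamma>_def)
  have \<pi>: "\<pi> \<in> hom \<Gamma> Q" using \<pi>_hom[of gen_a] by simp
  have ker_\<pi>: "kernel \<Gamma> Q \<pi> = coset ` K"
  proof -
    have "kernel \<Gamma> Q \<pi> = coset ` {w \<in> carrier F2. w \<in> K}"
      using \<pi>_coset q_one by (auto simp: kernel_def carrier_Gamma)
    also have "{w \<in> carrier F2. w \<in> K} = K" using K.subset by blast
    finally show ?thesis .
  qed
  have cyclic: "coset ` K = range (\<lambda>m::int. \<Gamma>.z [^]\<^bsub>\<Gamma>\<^esub> m)"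
  proof (intro equalityI subsetI)
    fix C assume "C \<in> coset ` K"
    then obtain w where C: "C = coset w" and "w \<in> K" by (rule imageE)
    from this(2) have w: "w \<in> carrier F2" "\<rho>4 w = \<one>\<^bsub>GL 4\<^esub>" using K_iff by blast+
    obtain m :: int where "coset w = \<Gamma>.z [^]\<^bsub>\<Gamma>\<^esub> m"
      using iffD1[OF kernel_rho4_iff[OF assms(4-6) w(1)] w(2)] by (rule exE)
    then show "C \<in> range (\<lambda>m::int. \<Gamma>.z [^]\<^bsub>\<Gamma>\<^esub> m)" unfolding C by (rule range_eqI)
  next
    fix C assume "C \<in> range (\<lambda>m::int. \<Gamma>.z [^]\<^bsub>\<Gamma>\<^esub> m)"
    then obtain m :: int where m: "C = \<Gamma>.z [^]\<^bsub>\<Gamma>\<^esub> m" by blast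
    have "C \<in> carrier \<Gamma>" unfolding m by (rule group.int_pow_closed[OF group_Gamma \<Gamma>.closed(7)])
    then obtain w where w: "w \<in> carrier F2" "C = coset w" unfolding carrier_Gamma by blast
    then have "\<exists>m::int. coset w = \<Gamma>.z [^]\<^bsub>\<Gamma>\<^esub> m" using m by metis
    then have "\<rho>4 w = \<one>\<^bsub>GL 4\<^esub>" by (rule iffD2[OF kernel_rho4_iff[OF assms(4-6) w(1)]])
    then have "w \<in> K" using K_iff w(1) by blast
    then show "C \<in> coset ` K" unfolding w(2) by (rule imageI)
  qed
  have epi: "\<pi> \<in> epi \<Gamma> Q"
    using \<pi> \<pi>_coset by (force simp: epi_def Q_def carrier_Gamma carrier_FactGroup image_image)
  have iso: "induced \<rho>44 \<in> iso (\<Gamma>\<lparr>carrier := kernel \<Gamma> Q \<pi>\<rparr>) ((GL 9)\<lparr>carrier := \<rho>44 ` K\<rparr>)"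
  proof -
    have sub: "coset ` K \<subseteq> carrier \<Gamma>" using K.subset by (auto simp: carrier_Gamma)
    have img: "induced \<rho>44 ` coset ` K = \<rho>44 ` K"
      unfolding image_image using K.subset ind44 by (intro image_cong) auto
    have "induced \<rho>44 \<in> hom (\<Gamma>\<lparr>carrier := coset ` K\<rparr>) ((GL 9)\<lparr>carrier := \<rho>44 ` K\<rparr>)"
      using mon sub img unfolding mon_def hom_def by (auto simp: subset_iff Pi_iff)
    moreover have "inj_on (induced \<rho>44) (coset ` K)"
      using mon sub inj_on_subset unfolding mon_def by blast
    ultimately show ?thesis using img by (simp add: iso_def bij_betw_def ker_\<pi>)
  qed
  have exact: "(\<exists>\<iota>. short_exact (Z_pow d) \<Gamma> Q \<iota> \<pi>) \<longleftrightarrow> d = 1" for d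
    using Z_pow_rank_one[OF group_Gamma \<Gamma>.closed(7) z_infinite_order[OF assms(1-3)], of d] epi group_Q group_Gamma
    by (auto simp: short_exact_def Z_pow_simps(3) ker_\<pi> cyclic)
  show ?thesis
    unfolding Let_def ker44 using P4_K mon iso exact
    by (simp add: \<Gamma>_def Q_def K_def \<pi>_def)
qed

end
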